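(* Each of the penalties $\mathrm{Pen}(\mathcal{T}_{\mathrm{comp}}^{\mathrm{nodist}}/\mathcal{T}_{\mathrm{comp}}^{\mathrm{dist}})$, $\mathrm{Pen}(\mathcal{T}_{\mathrm{blind}}^{\mathrm{nodist}}/\mathcal{T}_{\mathrm{blind}}^{\mathrm{dist}})$ and $\mathrm{Pen}(\mathcal{T}_{\mathrm{blind}}^{\mathrm{nodist}}/\mathcal{T}_{\mathrm{comp}}^{\mathrm{dist}})$ is $O(m)$, and for none of them is there a function $f$ with $f(m)\in o(m)$ such that the penalty is $O(f(m))$.
   Context: Treasure hunt in trees. A tree is a finite tree rooted at the starting node of a mobile agent; at each node of degree $\delta$ the incident edges carry port numbers $0,\dots,\delta-1$, assigned arbitrarily at each node. $h(T)$ is the depth of $T$. An instance is a pair $(T,d)$ with $T$ a tree and $1\le d\le h(T)$; a knowledge is a set of instances. For a tree $T^*$ and $1\le d^*\le h(T^* )$, let $P(T^* )$ be the set of trees obtained from $T^*$ by reassigning arbitrary port numbers at each node. Knowledge types (each ranging over all trees $T^*$ and admissible $d^*$): $\mathcal{T}_{\mathrm{comp}}^{\mathrm{dist}}$ consists of the sets $\{(T^*,d^* )\}$; $\mathcal{T}_{\mathrm{blind}}^{\mathrm{dist}}$ of the sets $\{(T,d^* ):T\in P(T^* )\}$; $\mathcal{T}_{\mathrm{comp}}^{\mathrm{nodist}}$ of the sets $\{(T^*,d):1\le d\le h(T^* )\}$; $\mathcal{T}_{\mathrm{blind}}^{\mathrm{nodist}}$ of the sets $\{(T,d):T\in P(T^*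 ),1\le d\le h(T^* )\}$. A deterministic algorithm given knowledge $K$ starts at the root; at each step it sees the port numbers at its current node, chooses one based on its history (initially $K$), traverses the edge and learns the entry port and degree of the new node. The cost $C_{\mathcal{A}}^K(T,d)$ is the number of edge traversals (including revisits) by $\mathcal{A}$ in $T$ until all nodes at distance exactly $d$ from the root are visited. With $B_m(K)=\{(T,d)\in K:d\le m\}$, the overhead is $\mathcal{O}_{\mathcal{A}}^K(m)=\max_{(T,d)\in B_m(K)}C_{\mathcal{A}}^K(T,d)/d$ if $B_m(K)\ne\emptyset$, else $0$. For knowledge types $\mathcal{T}_1\ll\mathcal{T}_2$ (every $K_1\in\mathcal{T}_1$ is contained in some $K_2\in\mathcal{T}_2$) and $f:\mathbb{N}\to\mathbb{N}$, $\mathrm{Pen}(\mathcal{T}_2/\mathcal{T}_1)$ is $O(f)$ if there exist a constant $c>0$ and a deterministic algorithm $\mathcal{A}_2$ such that for every deterministic algorithm $\mathcal{A}_1$, for all $K_2\in\mathcal{T}_2$ and all $m\ge1$: $\mathcal{O}_{\mathcal{A}_2}^{K_2}(m)\le c\cdot f(m)\cdot\max_{K_1\in\mathcal{T}_1,K_1\subseteq K_2}\mathcal{O}_{\mathcal{A}_1}^{K_1}(m)$. "$O(m)$" means $O(f)$ with $f(m)=m$. *)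

theory Defs
  imports "HOL-Library.Extended_Nonnegative_Real" "HOL-Library.Landau_Symbols"
begin

section \<open>Rooted trees with port numbers\<close>

text \<open>
  The list \<open>nbrs T v\<close> encodes the port numbering at \<open>v\<close>: its length is the degree of \<open>v\<close>, and
  port \<open>i\<close> of \<open>v\<close> leads to \<open>nbrs T v ! i\<close>.
\<close>

record ptree =
  nodes :: "nat set"
  root_node :: nat
  nbrs :: "nat \<Rightarrow> nat list"

definition adj :: "ptree \<Rightarrow> nat \<Rightarrow> nat \<Rightarrow> bool" where
  "adj T u v \<longleftrightarrow> v \<in> set (nbrs T u)"

definition degree :: "ptree \<Rightarrow> nat \<Rightarrow> nat" where
  "degree T v = length (nbrs T v)"

definition is_cycle :: "ptree \<Rightarrow> nat list \<Rightarrow> bool" where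
  "is_cycle T xs \<longleftrightarrow>
     3 \<le> length xs \<and> distinct xs \<and> successively (adj T) xs \<and> adj T (last xs) (hd xs)"

text \<open>
  The condition on \<open>v \<notin> nodes T\<close> makes the representation of a tree on a given node set
  unique, so that a tree has only finitely many renumberings of its ports.
\<close>

definition is_tree :: "ptree \<Rightarrow> bool" where
  "is_tree T \<longleftrightarrow>
     finite (nodes T) \<and> root_node T \<in> nodes T \<and>
     (\<forall>v. v \<notin> nodes T \<longrightarrow> nbrs T v = []) \<and>
     (\<forall>v\<in>nodes T. distinct (nbrs T v) \<and> set (nbrs T v) \<subseteq> nodes T - {v}) \<and>
     (\<forall>u v. adj T u v \<longrightarrow> adj T v u) \<and>
     (\<forall>u\<in>nodes T. \<forall>v\<in>nodes T. (adj T)\<^sup>*\<^sup>* u v) \<and>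
     (\<nexists>xs. is_cycle T xs)"

definition depth :: "ptree \<Rightarrow> nat \<Rightarrow> nat" where
  "depth T v = (LEAST n. (adj T ^^ n) (root_node T) v)"

definition height :: "ptree \<Rightarrow> nat" where
  "height T = Max (depth T ` nodes T)"

definition level :: "ptree \<Rightarrow> nat \<Rightarrow> nat set" where
  "level T d = {v \<in> nodes T. depth T v = d}"

definition port_to :: "ptree \<Rightarrow> nat \<Rightarrow> nat \<Rightarrow> nat" where
  "port_to T v u = (THE j. j < degree T v \<and> nbrs T v ! j = u)"

definition renumberings :: "ptree \<Rightarrow> ptree set" where
  "renumberings S =
     {T. is_tree T \<and> nodes T = nodes S \<and> root_node T = root_node S \<and>
         (\<forall>v. set (nbrs T v) = set (nbrs S v))}"


section \<open>Knowledge\<close>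

type_synonym knowledge = "(ptree \<times> nat) set"

definition comp_dist :: "knowledge set" where
  "comp_dist = {{(S, e)} | S e. is_tree S \<and> 1 \<le> e \<and> e \<le> height S}"

definition blind_dist :: "knowledge set" where
  "blind_dist =
     {{(T, e) | T. T \<in> renumberings S} | S e. is_tree S \<and> 1 \<le> e \<and> e \<le> height S}"

text \<open>
  In the two following definitions the existence of an admissible distance amounts to
  \<open>1 \<le> height S\<close>; it excludes the one-node tree, on which there is no instance.
\<close>

definition comp_nodist :: "knowledge set" where
  "comp_nodist =
     {{(S, d) | d. 1 \<le> d \<and> d \<le> height S} | S. is_tree S \<and> 1 \<le> height S}"

definition blind_nodist :: "knowledge set" where
  "blind_nodist =
     {{(T, d) | T d. T \<in> renumberings S \<and> 1 \<le> d \<and> d \<le> height S} | S.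
        is_tree S \<and> 1 \<le> height S}"

definition kt_below :: "knowledge set \<Rightarrow> knowledge set \<Rightarrow> bool" (infix \<open>\<lless>\<close> 50) where
  "\<T>\<^sub>1 \<lless> \<T>\<^sub>2 \<longleftrightarrow> (\<forall>K\<^sub>1\<in>\<T>\<^sub>1. \<exists>K\<^sub>2\<in>\<T>\<^sub>2. K\<^sub>1 \<subseteq> K\<^sub>2)"


section \<open>Algorithms, cost and overhead\<close>

text \<open>
  A history consists of the degree of the root and, for each move made so far in chronological
  order, the triple of the port taken, the port of entry at the new node, and the degree of the
  new node.
\<close>

type_synonym history = "nat \<times> (nat \<times> nat \<times> nat) list"

type_synonym algorithm = "knowledge \<Rightarrow> history \<Rightarrow> nat"

definition current_degree :: "history \<Rightarrow> nat" where
  "current_degree H = (if snd H = [] then fst H else snd (snd (last (snd H))))"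

definition is_algorithm :: "algorithm \<Rightarrow> bool" where
  "is_algorithm A \<longleftrightarrow> (\<forall>K H. 0 < current_degree H \<longrightarrow> A K H < current_degree H)"

fun run :: "algorithm \<Rightarrow> knowledge \<Rightarrow> ptree \<Rightarrow> nat \<Rightarrow> nat \<times> history" where
  "run A K T 0 = (root_node T, (degree T (root_node T), []))"
| "run A K T (Suc n) =
     (let (u, H) = run A K T n; p = A K H; v = nbrs T u ! p
      in (v, (fst H, snd H @ [(p, port_to T v u, degree T v)])))"

definition visited :: "algorithm \<Rightarrow> knowledge \<Rightarrow> ptree \<Rightarrow> nat \<Rightarrow> nat set" where
  "visited A K T n = (\<lambda>i. fst (run A K T i)) ` {..n}"

definition cost :: "algorithm \<Rightarrow> knowledge \<Rightarrow> ptree \<Rightarrow> nat \<Rightarrow> ennreal" where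
  "cost A K T d =
     (if \<exists>n. level T d \<subseteq> visited A K T n
      then of_nat (LEAST n. level T d \<subseteq> visited A K T n) else \<infinity>)"

definition restrict_dist :: "nat \<Rightarrow> knowledge \<Rightarrow> knowledge" where
  "restrict_dist m K = {(T, d) \<in> K. d \<le> m}"

text \<open>
  Maxima are rendered as suprema in \<^typ>\<open>ennreal\<close>: costs may be infinite, and all the knowledge
  sets above are finite.
\<close>

definition overhead :: "algorithm \<Rightarrow> knowledge \<Rightarrow> nat \<Rightarrow> ennreal" where
  "overhead A K m =
     (if restrict_dist m K = {} then 0
      else SUP (T, d) \<in> restrict_dist m K. cost A K T d / of_nat d)"


section \<open>Penalty\<close>

text \<open>\<open>pen_bigo \<T>\<^sub>2 \<T>\<^sub>1 f\<close> says that \<open>Pen(\<T>\<^sub>2/\<T>\<^sub>1)\<close> is \<open>O(f)\<close>.\<close>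

definition pen_bigo :: "knowledge set \<Rightarrow> knowledge set \<Rightarrow> (nat \<Rightarrow> nat) \<Rightarrow> bool" where
  "pen_bigo \<T>\<^sub>2 \<T>\<^sub>1 f \<longleftrightarrow>
     (\<exists>c::real. c > 0 \<and> (\<exists>A\<^sub>2. is_algorithm A\<^sub>2 \<and>
        (\<forall>A\<^sub>1. is_algorithm A\<^sub>1 \<longrightarrow>
           (\<forall>K\<^sub>2\<in>\<T>\<^sub>2. \<forall>m\<ge>1.
              overhead A\<^sub>2 K\<^sub>2 m
                \<le> ennreal c * of_nat (f m) * (SUP K\<^sub>1\<in>{K\<^sub>1\<in>\<T>\<^sub>1. K\<^sub>1 \<subseteq> K\<^sub>2}. overhead A\<^sub>1 K\<^sub>1 m)))))"


section \<open>Well-definedness\<close>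

lemma renumberings_refl: "is_tree S \<Longrightarrow> S \<in> renumberings S"
  by (simp add: renumberings_def)

lemma comp_dist_below_comp_nodist: "comp_dist \<lless> comp_nodist"
  unfolding kt_below_def
proof
  fix K assume "K \<in> comp_dist"
  then obtain S e where K: "K = {(S, e)}" and S: "is_tree S" "1 \<le> e" "e \<le> height S"
    unfolding comp_dist_def by blast
  let ?L = "{(S, d) | d. 1 \<le> d \<and> d \<le> height S}"
  have "1 \<le> height S" using S by simp
  then have "?L \<in> comp_nodist" using S(1) unfolding comp_nodist_def by blast
  moreover have "K \<subseteq> ?L" using K S by simp
  ultimately show "\<exists>L\<in>comp_nodist. K \<subseteq> L" by blast
qed

lemma blind_dist_below_blind_nodist: "blind_dist \<lless> blind_nodist"
  unfolding kt_below_def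
proof
  fix K assume "K \<in> blind_dist"
  then obtain S e where K: "K = {(T, e) | T. T \<in> renumberings S}"
    and S: "is_tree S" "1 \<le> e" "e \<le> height S"
    unfolding blind_dist_def by blast
  let ?L = "{(T, d) | T d. T \<in> renumberings S \<and> 1 \<le> d \<and> d \<le> height S}"
  have "1 \<le> height S" using S by simp
  then have "?L \<in> blind_nodist" using S(1) unfolding blind_nodist_def by blast
  moreover have "K \<subseteq> ?L" using K S by auto
  ultimately show "\<exists>L\<in>blind_nodist. K \<subseteq> L" by blast
qed

lemma comp_dist_below_blind_dist: "comp_dist \<lless> blind_dist"
  unfolding kt_below_def
proof
  fix K assume "K \<in> comp_dist"
  then obtain S e where K: "K = {(S, e)}" and S: "is_tree S" "1 \<le> e" "e \<le> height S"
    unfolding comp_dist_def by blast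
  let ?L = "{(T, e) | T. T \<in> renumberings S}"
  have "?L \<in> blind_dist" using S unfolding blind_dist_def by blast
  moreover have "K \<subseteq> ?L" using K renumberings_refl[OF S(1)] by simp
  ultimately show "\<exists>L\<in>blind_dist. K \<subseteq> L" by blast
qed

lemma comp_dist_below_blind_nodist: "comp_dist \<lless> blind_nodist"
  using comp_dist_below_blind_dist blind_dist_below_blind_nodist
  unfolding kt_below_def by (meson order_trans)

lemma finite_renumberings:
  assumes "is_tree S"
  shows "finite (renumberings S)"
proof -
  let ?V = "nodes S"
  let ?B = "{xs. set xs \<subseteq> ?V \<and> distinct xs}"
  let ?F = "{f. \<forall>v. (v \<in> ?V \<longrightarrow> f v \<in> ?B) \<and> (v \<notin> ?V \<longrightarrow> f v = [])}"
  have fin: "finite ?V" using assms by (simp add: is_tree_def)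
  have "finite ?B" using finite_subset_distinct[OF fin] by simp
  then have "finite ?F" using fin by (intro finite_set_of_finite_funs)
  moreover have "nbrs ` renumberings S \<subseteq> ?F"
  proof (rule image_subsetI)
    fix T assume "T \<in> renumberings S"
    then have T: "is_tree T" "nodes T = ?V" by (simp_all add: renumberings_def)
    have "set (nbrs T v) \<subseteq> ?V \<and> distinct (nbrs T v)" if "v \<in> ?V" for v
      using T that unfolding is_tree_def by (metis Diff_subset subset_trans)
    moreover have "nbrs T v = []" if "v \<notin> ?V" for v
      using T that by (simp add: is_tree_def)
    ultimately show "nbrs T \<in> ?F" by simp
  qed
  ultimately have "finite (nbrs ` renumberings S)" by (rule rev_finite_subset)
  moreover have "inj_on nbrs (renumberings S)"
    by (rule inj_onI) (simp add: renumberings_def)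
  ultimately show ?thesis by (rule finite_imageD)
qed

lemma finite_blind_nodist:
  assumes "K \<in> blind_nodist"
  shows "finite K"
proof -
  obtain S where S: "is_tree S"
    and K: "K = {(T, d) | T d. T \<in> renumberings S \<and> 1 \<le> d \<and> d \<le> height S}"
    using assms unfolding blind_nodist_def by blast
  have "K \<subseteq> renumberings S \<times> {..height S}" using K by auto
  then show ?thesis
    by (rule finite_subset) (simp add: finite_renumberings[OF S])
qed

end

theory Submission
  imports Defs "HOL-Library.Nat_Bijection" "HOL-Library.Transitive_Closure_Table"
begin

text \<open>
  Upper bound. Visiting level \<open>j\<close> takes at least as many moves as level \<open>j\<close> has nodes. Knowing the
  shape of the tree, but neither the ports nor the distance, the agent makes depth-first tours by
  the right-hand rule, the \<open>k\<close>-th one down to the largest depth \<open>r\<close> for which the levels \<open>1, \<dots>, r\<close>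
  have at most \<open>2 ^ k\<close> nodes in total. So level \<open>d\<close> is visited completely after \<open>O(b)\<close> moves, where
  \<open>b\<close> is the total size of the levels \<open>1, \<dots>, d\<close>. If every level \<open>j \<le> m\<close> has at most \<open>j * M\<close> nodes,
  this is \<open>O(d\<^sup>2 * M)\<close>, hence an overhead of \<open>O(m * M)\<close>.

  Lower bound. For \<open>i = 1, \<dots>, m\<close>, attach to the root a path of length \<open>i\<close> whose end carries
  \<open>m * i\<close> leaves. Whatever the ports are, an agent that knows \<open>d\<close> follows each path at most to
  depth \<open>d\<close> and visits only the leaves at depth \<open>d\<close>, with an overhead of at most \<open>4 * m\<close>. An agent
  that does not know \<open>d\<close> has to visit all of the roughly \<open>m\<^sup>3 / 2\<close> leaves of depth at most \<open>m\<close>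
  before the last of the levels \<open>1, \<dots>, m\<close> is complete, with an overhead of order \<open>m\<^sup>2\<close>.
\<close>

section \<open>Parents and children\<close>

definition children :: "ptree \<Rightarrow> nat \<Rightarrow> nat set" where
  "children T u = {v. adj T u v \<and> depth T v = Suc (depth T u)}"

definition parent :: "ptree \<Rightarrow> nat \<Rightarrow> nat" where
  "parent T v = (THE u. v \<in> children T u)"

lemma is_cycle_through_neighbours:
  assumes sym: "\<And>u w. adj T u w \<Longrightarrow> adj T w u"
    and nbrs: "adj T v a" "adj T v b" "a \<noteq> v" "a \<noteq> b"
    and path: "(\<lambda>u w. adj T u w \<and> w \<noteq> v)\<^sup>*\<^sup>* a b"
  shows "\<exists>xs. is_cycle T xs"
proof -
  let ?R = "\<lambda>u w. adj T u w \<and> w \<noteq> v"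
  obtain ys where "rtrancl_path ?R a ys b" using path unfolding rtranclp_eq_rtrancl_path ..
  then obtain xs where path_xs: "rtrancl_path ?R a xs b" "distinct (a # xs)"
    by (rule rtrancl_path_distinct)
  have nonempty: "xs \<noteq> []" using path_xs(1) nbrs(4) by cases auto
  have "v \<notin> set xs"
    using rtrancl_path_nth[OF path_xs(1)] by (metis in_set_conv_nth)
  moreover have "successively (adj T) (a # xs)"
    using rtrancl_path_nth[OF path_xs(1)] by (simp add: successively_conv_nth)
  ultimately have "is_cycle T (v # a # xs)"
    using path_xs(2) nbrs sym[OF nbrs(2)] nonempty rtrancl_path_last[OF path_xs(1) nonempty]
    by (auto simp: is_cycle_def Suc_le_eq)
  then show ?thesis ..
qed

lemma is_cycle_two_neighbours:
  assumes cycle: "is_cycle T xs" and x_in: "x \<in> set xs"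
    and sym: "\<And>u w. adj T u w \<Longrightarrow> adj T w u"
  obtains a b where "a \<in> set xs" "b \<in> set xs" "a \<noteq> b" "adj T x a" "adj T x b"
proof -
  obtain us vs where xs_split: "xs = us @ x # vs" using x_in by (meson split_list)
  let ?ys = "vs @ us"
  have rest: "2 \<le> length ?ys" "distinct ?ys" "set ?ys \<subseteq> set xs"
    using cycle by (auto simp: xs_split is_cycle_def)
  then have nonempty: "?ys \<noteq> []" by auto
  have walk: "successively (adj T) (x # vs)" "us \<noteq> [] \<Longrightarrow> adj T (last us) x"
    "adj T (last (x # vs)) (hd (us @ [x]))"
    using cycle by (auto simp: xs_split is_cycle_def successively_append_iff hd_append)
  have "adj T x (hd ?ys)"
    using walk(1,3) nonempty by (cases vs) auto
  moreover have "adj T x (last ?ys)"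
    using walk(2,3) nonempty sym by (cases us rule: rev_cases) simp_all
  moreover have "hd ?ys \<noteq> last ?ys"
    using rest by (cases ?ys) (auto simp: last_in_set split: if_splits)
  ultimately show thesis
    using that rest(3) hd_in_set[OF nonempty] last_in_set[OF nonempty] by blast
qed

locale rooted_tree =
  fixes T :: ptree
  assumes tree: "is_tree T"
begin

abbreviation root :: nat where
  "root \<equiv> root_node T"

lemma finite_nodes: "finite (nodes T)"
  and root_in_nodes: "root \<in> nodes T"
  and adj_sym: "adj T u v \<Longrightarrow> adj T v u"
  and connected: "u \<in> nodes T \<Longrightarrow> v \<in> nodes T \<Longrightarrow> (adj T)\<^sup>*\<^sup>* u v"
  and acyclic: "\<not> is_cycle T xs"
  using tree unfolding is_tree_def by blast+

lemma distinct_nbrs: "distinct (nbrs T v)"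
  using tree unfolding is_tree_def by (metis distinct.simps(1))

lemma adj_nodes:
  assumes "adj T u v"
  shows "u \<in> nodes T" "v \<in> nodes T"
  using assms adj_sym tree unfolding is_tree_def adj_def by (metis empty_iff empty_set)+

lemma adj_irrefl: "\<not> adj T v v"
  using tree adj_nodes(1)[of v v] unfolding is_tree_def adj_def by blast

lemma depth_le: "(adj T ^^ n) root v \<Longrightarrow> depth T v \<le> n"
  unfolding depth_def by (rule Least_le)

lemma depth_walk:
  assumes "v \<in> nodes T"
  shows "(adj T ^^ depth T v) root v"
  unfolding depth_def using connected[OF root_in_nodes assms] rtranclp_imp_relpowp LeastI_ex
  by (metis (mono_tags, lifting))

lemma depth_root [simp]: "depth T root = 0"
  using depth_le[of 0 root] by simp

lemma depth_eq_0_iff: "v \<in> nodes T \<Longrightarrow> depth T v = 0 \<longleftrightarrow> v = root"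
  using depth_walk by fastforce

lemma depth_adj_le: "adj T u v \<Longrightarrow> depth T v \<le> Suc (depth T u)"
  using depth_walk[OF adj_nodes(1)] by (intro depth_le) auto

lemma depth_le_height: "v \<in> nodes T \<Longrightarrow> depth T v \<le> height T"
  unfolding height_def using finite_nodes by (intro Max_ge) auto

lemma children_subset_nodes: "children T u \<subseteq> nodes T"
  using adj_nodes(2) by (auto simp: children_def)

lemma finite_children: "finite (children T u)"
  using children_subset_nodes finite_nodes by (rule finite_subset)

lemma children_subset_level: "children T u \<subseteq> level T (Suc (depth T u))"
  using adj_nodes(2) by (auto simp: children_def level_def)

lemma root_not_child: "root \<notin> children T u"
  by (auto simp: children_def)

lemma child_of_some_node:
  assumes "v \<in> nodes T" "v \<noteq> root"
  shows "\<exists>u. v \<in> children T u"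
proof -
  obtain n where depth_v: "depth T v = Suc n"
    using depth_eq_0_iff assms not0_implies_Suc by blast
  then obtain u where walk: "(adj T ^^ n) root u" "adj T u v"
    using depth_walk[OF assms(1)] by auto
  then have "depth T u = n"
    using depth_le[OF walk(1)] depth_adj_le[OF walk(2)] depth_v by simp
  then show ?thesis using walk(2) depth_v by (auto simp: children_def)
qed

lemma path_to_root_avoiding:
  assumes "x \<in> nodes T" "x \<noteq> v" "depth T x \<le> depth T v"
  shows "(\<lambda>u w. adj T u w \<and> u \<noteq> v \<and> w \<noteq> v)\<^sup>*\<^sup>* x root"
  using assms
proof (induction "depth T x" arbitrary: x rule: less_induct)
  case less
  show ?case
  proof (cases "x = root")
    case False
    then obtain u where "x \<in> children T u" using child_of_some_node less.prems(1) by blast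
    then have upwards: "adj T x u" "depth T x = Suc (depth T u)"
      using adj_sym by (auto simp: children_def)
    have "u \<in> nodes T" using upwards(1) by (rule adj_nodes(2))
    moreover have "u \<noteq> v" using upwards(2) less.prems(3) by auto
    ultimately have "(\<lambda>u w. adj T u w \<and> u \<noteq> v \<and> w \<noteq> v)\<^sup>*\<^sup>* u root"
      using less.hyps[of u] less.prems(3) upwards(2) by simp
    then show ?thesis
      using upwards(1) \<open>u \<noteq> v\<close> less.prems(2) by (simp add: converse_rtranclp_into_rtranclp)
  qed simp
qed

text \<open>Both neighbours are connected to the root, and hence to each other, without passing
  through \<open>v\<close>.\<close>

lemma shallower_neighbour_unique:
  assumes "adj T v a" "adj T v b" "depth T a \<le> depth T v" "depth T b \<le> depth T v"
  shows "a = b"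
proof (rule ccontr)
  let ?Q = "\<lambda>u w. adj T u w \<and> u \<noteq> v \<and> w \<noteq> v"
  assume "a \<noteq> b"
  have not_v: "a \<noteq> v" "b \<noteq> v" using assms adj_irrefl by auto
  then have "?Q\<^sup>*\<^sup>* a root" and to_root: "?Q\<^sup>*\<^sup>* b root"
    using path_to_root_avoiding assms adj_nodes(2) by blast+
  moreover have "symp ?Q" using adj_sym by (auto intro: sympI)
  then have "?Q\<^sup>*\<^sup>* root b" using to_root by (blast dest: sympD symp_rtranclp)
  ultimately have "?Q\<^sup>*\<^sup>* a b" by (blast intro: rtranclp_trans)
  then have "(\<lambda>u w. adj T u w \<and> w \<noteq> v)\<^sup>*\<^sup>* a b"
    by (rule rtranclp_mono[THEN predicate2D, rotated]) auto
  then show False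
    using is_cycle_through_neighbours[OF adj_sym] assms not_v \<open>a \<noteq> b\<close> acyclic by blast
qed

lemma parent_eqI:
  assumes "v \<in> children T u"
  shows "parent T v = u"
  unfolding parent_def
proof (rule the_equality)
  fix u' assume "v \<in> children T u'"
  then show "u' = u"
    using assms adj_sym by (intro shallower_neighbour_unique[of v]) (simp_all add: children_def)
qed (rule assms)

lemma child_of_parent: "v \<in> nodes T \<Longrightarrow> v \<noteq> root \<Longrightarrow> v \<in> children T (parent T v)"
  using child_of_some_node parent_eqI by blast

lemma parent_in_nodes: "v \<in> nodes T \<Longrightarrow> v \<noteq> root \<Longrightarrow> parent T v \<in> nodes T"
  using child_of_parent adj_nodes(1) by (force simp: children_def)

lemma depth_parent: "v \<in> nodes T \<Longrightarrow> v \<noteq> root \<Longrightarrow> depth T v = Suc (depth T (parent T v))"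
  using child_of_parent by (force simp: children_def)

lemma parent_induct [consumes 1, case_names root child]:
  assumes "v \<in> nodes T" and "P root"
    and "\<And>v. v \<in> nodes T \<Longrightarrow> v \<noteq> root \<Longrightarrow> P (parent T v) \<Longrightarrow> P v"
  shows "P v"
  using assms(1)
proof (induction "depth T v" arbitrary: v rule: less_induct)
  case less
  then show ?case
    using assms(2,3) parent_in_nodes depth_parent by (cases "v = root") auto
qed

lemma adj_iff_children: "adj T u v \<longleftrightarrow> v \<in> children T u \<or> u \<in> children T v"
proof
  assume adj: "adj T u v"
  have "depth T u \<noteq> depth T v"
  proof
    assume same_depth: "depth T u = depth T v"
    have "u \<noteq> root" using adj same_depth adj_irrefl adj_nodes(2) depth_eq_0_iff by fastforce
    then have "u \<in> children T (parent T u)" using adj adj_nodes(1) child_of_parent by blast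
    then have "adj T u (parent T u)" "depth T (parent T u) < depth T u"
      using adj_sym by (auto simp: children_def)
    then show False using shallower_neighbour_unique[OF adj] same_depth by fastforce
  qed
  then show "v \<in> children T u \<or> u \<in> children T v"
    using adj adj_sym depth_adj_le[of u v] depth_adj_le[of v u] by (auto simp: children_def)
qed (use adj_sym in \<open>auto simp: children_def\<close>)

lemma nbrs_root: "set (nbrs T root) = children T root"
  using adj_iff_children[of root] root_not_child by (simp add: adj_def set_eq_iff)

lemma nbrs_eq_insert_parent:
  assumes "v \<in> nodes T" "v \<noteq> root"
  shows "set (nbrs T v) = insert (parent T v) (children T v)" "parent T v \<notin> children T v"
proof -
  have "v \<in> children T u \<longleftrightarrow> u = parent T v" for u
    using child_of_parent[OF assms] parent_eqI by blast
  then show "set (nbrs T v) = insert (parent T v) (children T v)"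
    using adj_iff_children[of v] by (auto simp: adj_def)
  show "parent T v \<notin> children T v"
    using depth_parent[OF assms] by (simp add: children_def)
qed

lemma degree_eq_card_nbrs: "degree T v = card (set (nbrs T v))"
  using distinct_card[OF distinct_nbrs] by (simp add: degree_def)

lemma degree_eq_Suc_card_children:
  "v \<in> nodes T \<Longrightarrow> v \<noteq> root \<Longrightarrow> degree T v = Suc (card (children T v))"
  by (simp add: degree_eq_card_nbrs nbrs_eq_insert_parent finite_children)

lemma adj_nth: "i < degree T v \<Longrightarrow> adj T v (nbrs T v ! i)"
  by (simp add: adj_def degree_def)

lemma port_to_eqI: "i < degree T v \<Longrightarrow> nbrs T v ! i = u \<Longrightarrow> port_to T v u = i"
  unfolding port_to_def degree_def
  by (rule the_equality) (auto simp: distinct_nbrs nth_eq_iff_index_eq)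

lemma port_to:
  assumes "adj T v u"
  shows "port_to T v u < degree T v" "nbrs T v ! port_to T v u = u"
proof -
  obtain i where "i < degree T v" "nbrs T v ! i = u"
    using assms unfolding adj_def degree_def in_set_conv_nth by blast
  then show "port_to T v u < degree T v" "nbrs T v ! port_to T v u = u"
    using port_to_eqI by auto
qed

end

lemma
  assumes "is_tree S" "T \<in> renumberings S"
  shows root_renumbering: "root_node T = root_node S"
    and depth_renumbering: "depth T = depth S"
    and height_renumbering: "height T = height S"
    and level_renumbering: "level T = level S"
    and children_renumbering: "children T = children S"
    and degree_renumbering: "degree T = degree S"
proof -
  interpret T: rooted_tree T by unfold_locales (use assms in \<open>simp add: renumberings_def\<close>)
  interpret S: rooted_tree S by unfold_locales (fact assms(1))
  have same_nbrs: "set (nbrs T v) = set (nbrs S v)" for v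
    using assms(2) by (simp add: renumberings_def)
  then have adj: "adj T = adj S" by (simp add: fun_eq_iff adj_def)
  have nodes: "nodes T = nodes S" using assms(2) by (simp add: renumberings_def)
  show root: "root_node T = root_node S" using assms(2) by (simp add: renumberings_def)
  show depth: "depth T = depth S" by (simp add: fun_eq_iff depth_def adj root)
  show "height T = height S" "level T = level S" "children T = children S"
    by (simp_all add: fun_eq_iff height_def level_def children_def adj nodes depth)
  show "degree T = degree S"
    by (simp add: fun_eq_iff T.degree_eq_card_nbrs S.degree_eq_card_nbrs same_nbrs)
qed

section \<open>Tours by the right-hand rule\<close>

inductive_set explored :: "ptree \<Rightarrow> nat set \<Rightarrow> nat \<Rightarrow> nat set" for T X v where
  start: "v \<in> explored T X v"
| descend: "u \<in> explored T X v \<Longrightarrow> u \<notin> X \<Longrightarrow> w \<in> children T u \<Longrightarrow> w \<in> explored T X v"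

lemma explored_child: "v \<notin> X \<Longrightarrow> c \<in> children T v \<Longrightarrow> explored T X c \<subseteq> explored T X v"
proof
  fix w assume descent: "v \<notin> X" "c \<in> children T v" and "w \<in> explored T X c"
  from this(3) show "w \<in> explored T X v"
    by induction (use descent in \<open>blast intro: explored.intros\<close>)+
qed

lemma explored_stop: "v \<in> X \<Longrightarrow> explored T X v = {v}"
proof -
  assume stop: "v \<in> X"
  have "w = v" if "w \<in> explored T X v" for w using that by induction (use stop in auto)
  then show ?thesis by (auto intro: explored.start)
qed

lemma explored_unfold:
  assumes "v \<notin> X"
  shows "explored T X v = insert v (\<Union>c\<in>children T v. explored T X c)"
proof
  show "explored T X v \<subseteq> insert v (\<Union>c\<in>children T v. explored T X c)"
  proof
    fix w assume "w \<in> explored T X v"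
    then show "w \<in> insert v (\<Union>c\<in>children T v. explored T X c)"
      by induction (auto intro: explored.intros)
  qed
qed (use explored_child[OF assms] in \<open>auto intro: explored.start\<close>)

lemma explored_depth: "w \<in> explored T X v \<Longrightarrow> w = v \<or> depth T v < depth T w"
  by (induction rule: explored.induct) (auto simp: children_def)

lemma explored_cong:
  assumes "children T = children S"
  shows "explored T X v = explored S X v"
proof -
  have "explored T X v \<subseteq> explored S X v" if "children T = children S" for S T
  proof
    fix w assume "w \<in> explored T X v"
    then show "w \<in> explored S X v"
    proof induction
      case (descend u w)
      show ?case using descend.IH descend.hyps(2,3) unfolding that by (rule explored.descend)
    qed (rule explored.start)
  qed
  from this[OF assms] this[OF assms[symmetric]] show ?thesis by (rule equalityI)
qed

text \<open>A pair \<open>(v, q)\<close> records that the agent has entered \<open>v\<close> through port \<open>q\<close>.\<close>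

definition next_dart :: "ptree \<Rightarrow> nat set \<Rightarrow> nat \<times> nat \<Rightarrow> nat \<times> nat" where
  "next_dart T X = (\<lambda>(v, q).
     let w = nbrs T v ! ((if v \<in> X then q else Suc q) mod degree T v) in (w, port_to T w v))"

definition tour_covers ::
  "ptree \<Rightarrow> nat set \<Rightarrow> nat \<times> nat \<Rightarrow> nat \<Rightarrow> nat \<times> nat \<Rightarrow> nat set \<Rightarrow> bool" where
  "tour_covers T X x n y W \<longleftrightarrow>
     (next_dart T X ^^ n) x = y \<and> W \<subseteq> (\<lambda>i. fst ((next_dart T X ^^ i) x)) ` {..n}"

lemma tour_covers_refl: "tour_covers T X x 0 x {fst x}"
  by (simp add: tour_covers_def)

lemma tour_covers_step: "tour_covers T X x 1 (next_dart T X x) {}"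
  by (simp add: tour_covers_def)

lemma tour_covers_trans:
  assumes "tour_covers T X x n y W" "tour_covers T X y k z W'"
  shows "tour_covers T X x (n + k) z (W \<union> W')"
proof -
  let ?f = "next_dart T X"
  have midpoint: "(?f ^^ n) x = y" and endpoint: "(?f ^^ k) y = z"
    and W: "W \<subseteq> (\<lambda>i. fst ((?f ^^ i) x)) ` {..n}" and W': "W' \<subseteq> (\<lambda>i. fst ((?f ^^ i) y)) ` {..k}"
    using assms by (auto simp: tour_covers_def)
  have shift: "(?f ^^ (n + i)) x = (?f ^^ i) y" for i
    using midpoint by (simp add: add.commute[of n] funpow_add)
  have "W' \<subseteq> (\<lambda>i. fst ((?f ^^ (n + i)) x)) ` {..k}" using W' by (simp add: shift)
  also have "\<dots> \<subseteq> (\<lambda>i. fst ((?f ^^ i) x)) ` {..n + k}" by auto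
  finally have "W' \<subseteq> (\<lambda>i. fst ((?f ^^ i) x)) ` {..n + k}" .
  moreover have "W \<subseteq> (\<lambda>i. fst ((?f ^^ i) x)) ` {..n + k}" using W by fastforce
  ultimately show ?thesis using shift[of k] endpoint by (simp add: tour_covers_def)
qed

lemma tour_covers_chain:
  assumes "\<And>j. j < n \<Longrightarrow> tour_covers T X (x j) (l j) (x (Suc j)) (W j)"
  shows "tour_covers T X (x 0) (\<Sum>j<n. l j) (x n) (insert (fst (x 0)) (\<Union>j<n. W j))"
  using assms
proof (induction n)
  case 0
  show ?case using tour_covers_refl by simp
next
  case (Suc n)
  then have "tour_covers T X (x 0) ((\<Sum>j<n. l j) + l n) (x (Suc n))
      (insert (fst (x 0)) (\<Union>j<n. W j) \<union> W n)"
    by (intro tour_covers_trans) auto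
  then show ?case by (simp add: lessThan_Suc ac_simps)
qed

context rooted_tree
begin

lemma explored_subset_nodes: "v \<in> nodes T \<Longrightarrow> explored T X v \<subseteq> nodes T"
proof
  fix w assume v_node: "v \<in> nodes T" and "w \<in> explored T X v"
  from this(2) show "w \<in> nodes T" by induction (use v_node children_subset_nodes in auto)
qed

lemma finite_explored: "v \<in> nodes T \<Longrightarrow> finite (explored T X v)"
  using explored_subset_nodes finite_nodes finite_subset by blast

lemma explored_imp_ancestor:
  "w \<in> explored T X v \<Longrightarrow>
     depth T v \<le> depth T w \<and> (parent T ^^ (depth T w - depth T v)) w = v"
proof (induction rule: explored.induct)
  case (descend u w)
  then have "depth T w = Suc (depth T u)" "parent T w = u"
    using parent_eqI by (auto simp: children_def)
  then show ?case using descend.IH by (simp add: Suc_diff_le funpow_swap1)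
qed simp

lemma explored_siblings_disjoint:
  assumes "c \<in> children T v" "c' \<in> children T v" "c \<noteq> c'"
  shows "explored T X c \<inter> explored T X c' = {}"
proof -
  have "depth T c = depth T c'" using assms by (simp add: children_def)
  then show ?thesis
    using explored_imp_ancestor[of _ X c] explored_imp_ancestor[of _ X c'] assms(3) by fastforce
qed

lemma card_explored:
  assumes "v \<in> nodes T" "v \<notin> X"
  shows "card (explored T X v) = Suc (\<Sum>c\<in>children T v. card (explored T X c))"
proof -
  have "v \<notin> (\<Union>c\<in>children T v. explored T X c)"
    using explored_depth by (fastforce simp: children_def)
  moreover have "card (\<Union>c\<in>children T v. explored T X c)
      = (\<Sum>c\<in>children T v. card (explored T X c))"
    using finite_children finite_explored children_subset_nodes explored_siblings_disjoint
    by (intro card_UN_disjoint) blast+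
  moreover have "finite (\<Union>c\<in>children T v. explored T X c)"
    using finite_children finite_explored children_subset_nodes by blast
  ultimately show ?thesis using explored_unfold[OF assms(2), of T] by simp
qed

lemma explored_root_iff_parent:
  assumes "v \<in> nodes T" "v \<noteq> root"
  shows "v \<in> explored T X root \<longleftrightarrow> parent T v \<in> explored T X root \<and> parent T v \<notin> X"
proof
  assume "v \<in> explored T X root"
  then show "parent T v \<in> explored T X root \<and> parent T v \<notin> X"
    by cases (use assms(2) parent_eqI in auto)
qed (use child_of_parent[OF assms] in \<open>blast intro: explored.descend\<close>)

abbreviation nbr_after :: "nat \<Rightarrow> nat \<Rightarrow> nat \<Rightarrow> nat" where
  "nbr_after v q j \<equiv> nbrs T v ! (Suc (q + j) mod degree T v)"

lemma bij_betw_nbr_after: "bij_betw (nbr_after v q) {..<degree T v} (set (nbrs T v))"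
proof -
  have "bij_betw ((!) (rotate (Suc q) (nbrs T v))) {..<degree T v} (set (nbrs T v))"
    by (rule bij_betw_nth) (simp_all add: distinct_nbrs degree_def)
  then show ?thesis
    by (rule bij_betw_cong[THEN iffD1, rotated]) (simp add: nth_rotate degree_def del: rotate_Suc)
qed

lemma bij_betw_nbr_after_parent:
  assumes "v \<in> nodes T" "v \<noteq> root"
  shows "bij_betw (nbr_after v (port_to T v (parent T v))) {..<degree T v - 1} (children T v)"
proof -
  let ?q = "port_to T v (parent T v)" and ?\<delta> = "degree T v"
  note parent = nbrs_eq_insert_parent[OF assms]
  have parent_port: "?q < ?\<delta>" "nbrs T v ! ?q = parent T v"
    using port_to parent by (auto simp: adj_def)
  have "Suc (?q + (?\<delta> - 1)) = ?q + ?\<delta>" using parent_port by simp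
  then have "nbr_after v ?q (?\<delta> - 1) = parent T v" using parent_port by simp
  then have "bij_betw (nbr_after v ?q) ({..<?\<delta>} - {?\<delta> - 1}) (set (nbrs T v) - {parent T v})"
    using parent_port parent by (intro bij_betw_DiffI bij_betw_nbr_after) auto
  moreover have "{..<?\<delta>} - {?\<delta> - 1} = {..<?\<delta> - 1}" by auto
  moreover have "set (nbrs T v) - {parent T v} = children T v" using parent by auto
  ultimately show ?thesis by simp
qed

definition detour :: "nat set \<Rightarrow> nat \<Rightarrow> nat \<Rightarrow> bool" where
  "detour X v c \<longleftrightarrow> (\<forall>p. c = nbrs T v ! (Suc p mod degree T v) \<longrightarrow>
     tour_covers T X (v, p) (2 * card (explored T X c)) (v, Suc p mod degree T v)
       (explored T X c))"

lemma tour_through_children: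
  assumes node: "v \<in> nodes T" "v \<notin> X" "q < degree T v"
    and bij: "bij_betw (nbr_after v q) {..<n} (children T v)"
    and detours: "\<And>c. c \<in> children T v \<Longrightarrow> detour X v c"
  shows "tour_covers T X (v, q) (2 * card (explored T X v - {v})) (v, (q + n) mod degree T v)
    (explored T X v)"
proof -
  let ?\<delta> = "degree T v" and ?c = "nbr_after v q"
  have "tour_covers T X (v, (q + j) mod ?\<delta>) (2 * card (explored T X (?c j)))
      (v, (q + Suc j) mod ?\<delta>) (explored T X (?c j))" if "j < n" for j
  proof -
    have "detour X v (?c j)" using bij_betwE[OF bij] that by (intro detours) blast
    moreover have "Suc ((q + j) mod ?\<delta>) mod ?\<delta> = (q + Suc j) mod ?\<delta>" by (simp add: mod_Suc_eq)
    ultimately show ?thesis unfolding detour_def by (metis add_Suc_right)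
  qed
  from tour_covers_chain[where n = n and x = "\<lambda>j. (v, (q + j) mod ?\<delta>)", OF this]
  have "tour_covers T X (v, q) (\<Sum>j<n. 2 * card (explored T X (?c j))) (v, (q + n) mod ?\<delta>)
      (insert v (\<Union>j<n. explored T X (?c j)))"
    using node(3) by simp
  moreover have "(\<Sum>j<n. 2 * card (explored T X (?c j))) = 2 * card (explored T X v - {v})"
    using sum.reindex_bij_betw[OF bij, of "\<lambda>c. 2 * card (explored T X c)"]
      card_explored[OF node(1,2)]
    by (simp add: explored.start sum_distrib_left)
  moreover have "insert v (\<Union>j<n. explored T X (?c j)) = explored T X v"
    by (simp add: explored_unfold[OF node(2)] flip: bij_betw_imp_surj_on[OF bij])
  ultimately show ?thesis by simp
qed

lemma tour_inside_subtree:
  assumes child: "c \<in> children T u"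
    and detours: "\<And>c'. c \<notin> X \<Longrightarrow> c' \<in> children T c \<Longrightarrow> detour X c c'"
  obtains p where
    "tour_covers T X (c, port_to T c u) (2 * card (explored T X c - {c})) (c, p) (explored T X c)"
    "(if c \<in> X then p else Suc p) mod degree T c = port_to T c u"
proof (cases "c \<in> X")
  case True
  have "port_to T c u < degree T c"
    using port_to(1) child adj_sym by (simp add: children_def)
  then show ?thesis
    using that[of "port_to T c u"] tour_covers_refl[of T X "(c, port_to T c u)"] True
    by (simp add: explored_stop)
next
  case False
  let ?q = "port_to T c u" and ?\<delta> = "degree T c"
  have node: "c \<in> nodes T" "c \<noteq> root" "parent T c = u"
    using child children_subset_nodes root_not_child parent_eqI by auto
  have entry_port: "?q < ?\<delta>" using port_to(1) child adj_sym by (simp add: children_def)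
  have "tour_covers T X (c, ?q) (2 * card (explored T X c - {c}))
      (c, (?q + (?\<delta> - 1)) mod ?\<delta>) (explored T X c)"
    using bij_betw_nbr_after_parent[OF node(1,2)] node entry_port False detours
    by (intro tour_through_children) auto
  moreover have "Suc ((?q + (?\<delta> - 1)) mod ?\<delta>) mod ?\<delta> = ?q"
    using entry_port by (simp add: mod_Suc_eq)
  ultimately show ?thesis using that False by simp
qed

lemma detour_child:
  assumes "u \<notin> X" "c \<in> children T u"
  shows "detour X u c"
  using assms
proof (induction "card (explored T X c)" arbitrary: u c rule: less_induct)
  case (less c)
  let ?q = "port_to T c u"
  have node: "c \<in> nodes T" using less.prems(2) children_subset_nodes by blast
  have "card (explored T X c') < card (explored T X c)" if "c \<notin> X" "c' \<in> children T c" for c'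
    using that finite_children member_le_sum[of c' "children T c" "\<lambda>c. card (explored T X c)"]
    by (simp add: card_explored[OF node that(1)] less_Suc_eq_le)
  then obtain p' where inside:
    "tour_covers T X (c, ?q) (2 * card (explored T X c - {c})) (c, p') (explored T X c)"
    and last_port: "(if c \<in> X then p' else Suc p') mod degree T c = ?q"
    using tour_inside_subtree[OF less.prems(2)] less.hyps by metis
  show ?case
    unfolding detour_def
  proof (intro allI impI)
    fix p assume next_nbr: "c = nbrs T u ! (Suc p mod degree T u)"
    have "0 < degree T u" using less.prems(2) by (auto simp: children_def adj_def degree_def)
    then have exit_port: "port_to T u c = Suc p mod degree T u"
      using next_nbr by (intro port_to_eqI) auto
    have enter: "next_dart T X (u, p) = (c, ?q)"
      using next_nbr less.prems by (simp add: next_dart_def Let_def)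
    have leave: "next_dart T X (c, p') = (u, Suc p mod degree T u)"
      using last_port port_to(2) less.prems(2) adj_sym exit_port
      by (simp add: next_dart_def Let_def children_def)
    have "tour_covers T X (u, p) (1 + (2 * card (explored T X c - {c}) + 1))
        (u, Suc p mod degree T u) ({} \<union> (explored T X c \<union> {}))"
      using tour_covers_step[of T X "(u, p)"] tour_covers_step[of T X "(c, p')"] enter leave inside
      by (intro tour_covers_trans) auto
    moreover have "card (explored T X c) = Suc (card (explored T X c - {c}))"
      by (rule card.remove[OF finite_explored[OF node] explored.start])
    ultimately show "tour_covers T X (u, p) (2 * card (explored T X c)) (u, Suc p mod degree T u)
        (explored T X c)"
      by simp
  qed
qed

text \<open>The agent starts as if it had entered the root through its last port.\<close>

definition start_dart :: "nat \<times> nat" where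
  "start_dart = (root, degree T root - 1)"

lemma tour_of_root:
  "tour_covers T X start_dart (2 * card (explored T X root - {root})) start_dart
     (explored T X root)"
proof (cases "root \<in> X \<or> degree T root = 0")
  case True
  then have "explored T X root = {root}"
    using explored_stop[of root X T] explored_unfold[of root X T]
    by (cases "root \<in> X") (simp_all add: degree_def flip: nbrs_root)
  then show ?thesis using tour_covers_refl[of T X start_dart] by (simp add: start_dart_def)
next
  case False
  let ?\<delta> = "degree T root"
  have "bij_betw (nbr_after root (?\<delta> - 1)) {..<?\<delta>} (children T root)"
    using bij_betw_nbr_after[of root] by (simp only: nbrs_root)
  then have "tour_covers T X (root, ?\<delta> - 1) (2 * card (explored T X root - {root}))
      (root, (?\<delta> - 1 + ?\<delta>) mod ?\<delta>) (explored T X root)"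
    using False root_in_nodes detour_child by (intro tour_through_children) auto
  then show ?thesis using False by (simp add: start_dart_def)
qed

end

section \<open>Algorithms that follow the right-hand rule\<close>

text \<open>The ports leading to the parent, along the path from the current node to the root; its length
  is the current depth. A move through the port on top of the stack goes up.\<close>

definition parent_ports :: "(nat \<times> nat \<times> nat) list \<Rightarrow> nat list" where
  "parent_ports = foldl (\<lambda>s (p, q, _). if s \<noteq> [] \<and> p = hd s then tl s else q # s) []"

definition entry_port :: "history \<Rightarrow> nat" where
  "entry_port H = (if snd H = [] then fst H - 1 else fst (snd (last (snd H))))"

definition tour :: "(knowledge \<Rightarrow> nat \<Rightarrow> nat \<Rightarrow> nat \<Rightarrow> bool) \<Rightarrow> algorithm" where
  "tour turn_back K H =
     (if turn_back K (length (snd H)) (length (parent_ports (snd H))) (current_degree H)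
      then entry_port H else Suc (entry_port H)) mod current_degree H"

lemma is_algorithm_tour: "is_algorithm (tour turn_back)"
  by (simp add: is_algorithm_def tour_def)

lemma length_run: "length (snd (snd (run A K T n))) = n"
  by (induction n) (simp_all add: case_prod_beta Let_def)

definition dart :: "algorithm \<Rightarrow> knowledge \<Rightarrow> ptree \<Rightarrow> nat \<Rightarrow> nat \<times> nat" where
  "dart A K T n = map_prod id entry_port (run A K T n)"

lemma visited_eq_dart: "visited A K T n = (\<lambda>i. fst (dart A K T i)) ` {..n}"
  by (simp add: visited_def dart_def fst_map_prod)

context rooted_tree
begin

definition path_ports :: "nat \<Rightarrow> nat list" where
  "path_ports v =
     map (\<lambda>i. let u = (parent T ^^ i) v in port_to T u (parent T u)) [0..<depth T v]"

lemma length_path_ports [simp]: "length (path_ports v) = depth T v"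
  by (simp add: path_ports_def)

lemma path_ports_child:
  assumes "v \<in> children T u"
  shows "path_ports v = port_to T v u # path_ports u"
proof -
  have "depth T v = Suc (depth T u)" "parent T v = u"
    using assms parent_eqI by (auto simp: children_def)
  then show ?thesis
    by (simp add: path_ports_def Let_def upt_conv_Cons funpow_Suc_right map_Suc_upt[symmetric]
        del: upt_Suc funpow.simps(2))
qed

lemma path_ports_move:
  assumes "adj T u v"
  shows "(if path_ports u \<noteq> [] \<and> port_to T u v = hd (path_ports u)
    then tl (path_ports u) else port_to T v u # path_ports u) = path_ports v"
  using assms unfolding adj_iff_children
proof
  assume child: "v \<in> children T u"
  have "port_to T u v \<noteq> hd (path_ports u)" if "path_ports u \<noteq> []"
  proof
    assume top_of_stack: "port_to T u v = hd (path_ports u)"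
    have u_node: "u \<in> nodes T" "u \<noteq> root" using assms adj_nodes that by (auto simp: path_ports_def)
    then have "port_to T u v = port_to T u (parent T u)"
      using top_of_stack path_ports_child[OF child_of_parent] by simp
    then have "v = parent T u"
      using port_to(2) assms nbrs_eq_insert_parent(1)[OF u_node] by (metis adj_def insertI1)
    then show False using child nbrs_eq_insert_parent(2)[OF u_node] by simp
  qed
  then show ?thesis using path_ports_child[OF child] by auto
qed (simp add: path_ports_child)

end

locale nontrivial_rooted_tree = rooted_tree +
  assumes height_pos: "1 \<le> height T"
begin

lemma children_root_nonempty: "children T root \<noteq> {}"
proof
  assume "children T root = {}"
  then have "explored T {} root = {root}" using explored_unfold[of root "{}"] by simp
  moreover have "v \<in> explored T {} root" if "v \<in> nodes T" for v
    using that by (induction rule: parent_induct)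
      (simp_all add: explored.start explored_root_iff_parent)
  ultimately have "nodes T = {root}" using root_in_nodes by blast
  then show False using height_pos by (simp add: height_def)
qed

lemma degree_root_pos: "0 < degree T root"
  using children_root_nonempty nbrs_root by (auto simp: degree_def)

lemma run_consistent:
  assumes "is_algorithm A" "run A K T n = (v, H)"
  shows "v \<in> nodes T \<and> current_degree H = degree T v \<and> entry_port H < degree T v \<and>
    parent_ports (snd H) = path_ports v"
  using assms(2)
proof (induction n arbitrary: v H)
  case 0
  then show ?case
    using degree_root_pos root_in_nodes
    by (auto simp: current_degree_def entry_port_def parent_ports_def path_ports_def)
next
  case (Suc n)
  obtain u G where run: "run A K T n = (u, G)" by (cases "run A K T n")
  define p where "p = A K G"
  note IH = Suc.IH[OF run]
  have port_less: "p < degree T u"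
    using IH assms(1)[unfolded is_algorithm_def, rule_format, of G K] by (simp add: p_def)
  have next_node: "v = nbrs T u ! p"
    and next_history: "H = (fst G, snd G @ [(p, port_to T v u, degree T v)])"
    using Suc.prems run by (auto simp: Let_def p_def)
  have adj: "adj T u v" "adj T v u" using adj_nth[OF port_less] next_node adj_sym by auto
  have "port_to T u v = p" using port_to_eqI port_less next_node by simp
  then have "parent_ports (snd H) = path_ports v"
    using IH path_ports_move[OF adj(1)] by (simp add: next_history parent_ports_def)
  then show ?case
    using next_history adj_nodes(2)[OF adj(1)] port_to(1)[OF adj(2)]
    by (simp add: current_degree_def entry_port_def)
qed

lemma dart_0: "dart A K T 0 = start_dart"
  by (simp add: dart_def entry_port_def start_dart_def)

lemma dart_tour_Suc:
  "dart (tour turn_back) K T (Suc n)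
     = next_dart T {v. turn_back K n (depth T v) (degree T v)} (dart (tour turn_back) K T n)"
proof -
  obtain v H where run: "run (tour turn_back) K T n = (v, H)"
    by (cases "run (tour turn_back) K T n")
  then show ?thesis
    using run_consistent[OF is_algorithm_tour run] length_run[of "tour turn_back" K T n]
    by (simp add: dart_def next_dart_def entry_port_def[of "(_, _ @ _)"] tour_def Let_def)
qed

lemma tour_phases:
  fixes X :: "nat \<Rightarrow> nat set" and duration :: "nat \<Rightarrow> nat"
  assumes duration: "\<And>j. duration j = 2 * card (explored T (X j) root - {root})"
    and turn_back: "\<And>j i. i < duration j \<Longrightarrow>
      {v. turn_back K (sum duration {..<j} + i) (depth T v) (degree T v)} = X j"
  shows "explored T (X k) root \<subseteq> visited (tour turn_back) K T (sum duration {..k})"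
proof -
  let ?dart = "dart (tour turn_back) K T" and ?start = "\<lambda>j. sum duration {..<j}"
  have phase: "?dart (?start j + i) = (next_dart T (X j) ^^ i) (?dart (?start j))"
    if "i \<le> duration j" for i j
    using that by (induction i) (simp_all add: dart_tour_Suc turn_back)
  have tour: "tour_covers T (X j) start_dart (duration j) start_dart (explored T (X j) root)" for j
    unfolding duration by (rule tour_of_root)
  have start: "?dart (?start j) = start_dart" for j
    by (induction j) (use tour in \<open>simp_all add: dart_0 phase tour_covers_def\<close>)
  have "explored T (X k) root \<subseteq> (\<lambda>i. fst (?dart (?start k + i))) ` {..duration k}"
    using tour[of k] by (simp add: phase start tour_covers_def)
  also have "\<dots> \<subseteq> visited (tour turn_back) K T (sum duration {..k})"
    by (auto simp: visited_eq_dart simp flip: lessThan_Suc_atMost)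
  finally show ?thesis .
qed

lemma tour_single_phase:
  assumes "\<And>n. {v. turn_back K n (depth T v) (degree T v)} = X"
  shows "explored T X root \<subseteq> visited (tour turn_back) K T (2 * card (explored T X root - {root}))"
  using tour_phases[of "\<lambda>_. 2 * card (explored T X root - {root})" "\<lambda>_. X" turn_back K 0] assms
  by simp

end

section \<open>Cost and overhead\<close>

lemma visited_mono: "n \<le> n' \<Longrightarrow> visited A K T n \<subseteq> visited A K T n'"
  unfolding visited_def by (rule image_mono) simp

lemma card_visited_minus_root: "card (visited A K T n - {root_node T}) \<le> n"
proof -
  have "root_node T \<in> visited A K T n"
    unfolding visited_def by (rule image_eqI[of _ _ 0]) auto
  moreover have "card (visited A K T n) \<le> Suc n"
    unfolding visited_def using card_image_le[of "{..n}"] by simp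
  ultimately show ?thesis by simp
qed

lemma cost_le_iff: "cost A K T d \<le> of_nat n \<longleftrightarrow> level T d \<subseteq> visited A K T n"
proof (cases "\<exists>k. level T d \<subseteq> visited A K T k")
  case True
  let ?l = "LEAST k. level T d \<subseteq> visited A K T k"
  have "?l \<le> n \<longleftrightarrow> level T d \<subseteq> visited A K T n"
    using LeastI_ex[OF True] visited_mono[of ?l n A K T] by (auto intro: Least_le)
  then show ?thesis using True by (simp add: cost_def)
next
  case False
  then show ?thesis by (auto simp: cost_def top_unique)
qed

lemma cost_cases: obtains "cost A K T d = \<infinity>" | n where "cost A K T d = of_nat n"
  using that by (cases "\<exists>n. level T d \<subseteq> visited A K T n") (auto simp: cost_def)

lemma (in rooted_tree) sum_card_levels_le_cost:
  assumes "finite D" "D \<noteq> {}" "0 \<notin> D"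
  obtains d where "d \<in> D" "of_nat (\<Sum>d\<in>D. card (level T d)) \<le> cost A K T d"
proof -
  have "Max (cost A K T ` D) \<in> cost A K T ` D" using assms(1,2) by (intro Max_in) auto
  then obtain d where maximal: "d \<in> D" "cost A K T d = Max (cost A K T ` D)" by (metis imageE)
  show thesis
  proof (rule cost_cases[of A K T d])
    fix n assume finite_cost: "cost A K T d = of_nat n"
    have "cost A K T j \<le> of_nat n" if "j \<in> D" for j
      using that assms(1) finite_cost maximal(2) by (metis Max_ge finite_imageI imageI)
    then have levels: "(\<Union>j\<in>D. level T j) \<subseteq> visited A K T n - {root}"
      using assms(3) by (auto simp: cost_le_iff level_def)
    have "(\<Sum>j\<in>D. card (level T j)) = card (\<Union>j\<in>D. level T j)"
      using assms(1) finite_nodes by (subst card_UN_disjoint) (auto simp: level_def)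
    also have "\<dots> \<le> card (visited A K T n - {root})"
      using levels by (rule card_mono[rotated]) (simp add: visited_def)
    also have "\<dots> \<le> n" by (rule card_visited_minus_root)
    finally show thesis using that maximal(1) finite_cost by (simp only: of_nat_le_iff)
  qed (use that[OF maximal(1)] in simp)
qed

lemma cost_le_overhead:
  assumes "(T, d) \<in> K" "1 \<le> d" "d \<le> m"
  shows "cost A K T d \<le> of_nat d * overhead A K m"
proof -
  have member: "(T, d) \<in> restrict_dist m K" using assms by (simp add: restrict_dist_def)
  have "cost A K T d = of_nat d * (cost A K T d / of_nat d)"
    using assms(2) mult_divide_eq_ennreal[of "of_nat d" "cost A K T d"]
    by (simp add: ennreal_times_divide mult.commute[of "of_nat d"])
  also have "cost A K T d / of_nat d \<le> overhead A K m"
    using member by (auto simp: overhead_def intro: SUP_upper2)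
  finally show ?thesis by (simp add: mult_left_mono)
qed

lemma overhead_leI:
  assumes "\<And>T d. (T, d) \<in> K \<Longrightarrow> d \<le> m \<Longrightarrow> 1 \<le> d \<and> cost A K T d \<le> of_nat d * M"
  shows "overhead A K m \<le> M"
proof -
  have "cost A K T d / of_nat d \<le> M" if "(T, d) \<in> restrict_dist m K" for T d
    using assms[of T d] that by (intro divide_le_posI_ennreal) (auto simp: restrict_dist_def)
  then show ?thesis unfolding overhead_def by (auto intro!: SUP_least)
qed

section \<open>Searching balls of doubling size\<close>

definition block_index :: "(nat \<Rightarrow> nat) \<Rightarrow> nat \<Rightarrow> nat" where
  "block_index l n = (LEAST k. n < sum l {..k})"

lemma block_index_eq:
  assumes "i < l k"
  shows "block_index l (sum l {..<k} + i) = k"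
  unfolding block_index_def
proof (rule Least_equality)
  show "sum l {..<k} + i < sum l {..k}" using assms by (simp flip: lessThan_Suc_atMost)
next
  fix j assume later: "sum l {..<k} + i < sum l {..j}"
  show "k \<le> j"
  proof (rule ccontr)
    assume "\<not> k \<le> j"
    then have "sum l {..j} \<le> sum l {..<k}" by (intro sum_mono2) auto
    then show False using later by simp
  qed
qed

definition punctured_ball :: "ptree \<Rightarrow> nat \<Rightarrow> nat set" where
  "punctured_ball T r = (\<Union>d\<in>{1..r}. level T d)"

lemma mem_punctured_ball_iff:
  "v \<in> punctured_ball T r \<longleftrightarrow> v \<in> nodes T \<and> 1 \<le> depth T v \<and> depth T v \<le> r"
  by (auto simp: punctured_ball_def level_def)

definition radius :: "ptree \<Rightarrow> nat \<Rightarrow> nat" where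
  "radius T k = Max {r. r \<le> height T \<and> card (punctured_ball T r) \<le> 2 ^ k}"

definition phase_length :: "ptree \<Rightarrow> nat \<Rightarrow> nat" where
  "phase_length T k = 2 * card (punctured_ball T (radius T k))"

definition known_tree :: "knowledge \<Rightarrow> ptree" where
  "known_tree K = fst (SOME x. x \<in> K)"

lemma known_tree_in: "K \<noteq> {} \<Longrightarrow> known_tree K \<in> fst ` K"
  using some_in_eq by (auto simp: known_tree_def)

definition doubling_tour :: algorithm where
  "doubling_tour =
     tour (\<lambda>K n k _. radius (known_tree K) (block_index (phase_length (known_tree K)) n) \<le> k)"

lemma radius_renumbering:
  assumes "is_tree S" "T \<in> renumberings S"
  shows "radius T = radius S" "phase_length T = phase_length S"
  by (simp_all add: fun_eq_iff radius_def phase_length_def punctured_ball_def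
      height_renumbering[OF assms] level_renumbering[OF assms])

lemma finite_radii: "finite {r. r \<le> height T \<and> card (punctured_ball T r) \<le> 2 ^ k}"
  by (rule finite_subset[of _ "{..height T}"]) auto

lemma le_radius: "r \<le> height T \<Longrightarrow> card (punctured_ball T r) \<le> 2 ^ k \<Longrightarrow> r \<le> radius T k"
  unfolding radius_def using finite_radii by (intro Max_ge) auto

lemma card_ball_radius_le: "card (punctured_ball T (radius T k)) \<le> 2 ^ k"
proof -
  have "0 \<in> {r. r \<le> height T \<and> card (punctured_ball T r) \<le> 2 ^ k}"
    by (simp add: punctured_ball_def)
  then have "radius T k \<in> {r. r \<le> height T \<and> card (punctured_ball T r) \<le> 2 ^ k}"
    unfolding radius_def using finite_radii by (intro Max_in) auto
  then show ?thesis by simp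
qed

lemma sum_phase_length_le: "sum (phase_length T) {..k} \<le> 4 * 2 ^ k"
proof (induction k)
  case 0
  show ?case using card_ball_radius_le[of T 0] by (simp add: phase_length_def)
next
  case (Suc k)
  then show ?case using card_ball_radius_le[of T "Suc k"] by (simp add: phase_length_def)
qed

lemma (in rooted_tree) explored_within_radius:
  "explored T {v. r \<le> depth T v} root - {root} = punctured_ball T r"
proof -
  have "v \<in> explored T {v. r \<le> depth T v} root \<longleftrightarrow> v = root \<or> depth T v \<le> r"
    if "v \<in> nodes T" for v
    using that
  proof (induction rule: parent_induct)
    case (child v)
    then show ?case
      by (auto simp: explored_root_iff_parent[OF child.hyps] depth_parent[OF child.hyps])
  qed (simp add: explored.start)
  moreover have "v \<in> punctured_ball T r \<longleftrightarrow> v \<noteq> root \<and> depth T v \<le> r" if "v \<in> nodes T" for v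
    using that depth_eq_0_iff[OF that] by (auto simp: mem_punctured_ball_iff Suc_le_eq)
  moreover have "explored T {v. r \<le> depth T v} root \<subseteq> nodes T" "punctured_ball T r \<subseteq> nodes T"
    by (rule explored_subset_nodes[OF root_in_nodes]) (auto simp: mem_punctured_ball_iff)
  ultimately show ?thesis by blast
qed

context nontrivial_rooted_tree
begin

lemma card_punctured_ball_pos:
  assumes "1 \<le> r"
  shows "0 < card (punctured_ball T r)"
proof -
  have "children T root \<subseteq> level T 1" using children_subset_level[of root] by simp
  also have "\<dots> \<subseteq> punctured_ball T r" using assms by (auto simp: mem_punctured_ball_iff level_def)
  finally have "punctured_ball T r \<noteq> {}" using children_root_nonempty by blast
  moreover have "finite (punctured_ball T r)"
    by (rule finite_subset[OF _ finite_nodes]) (auto simp: mem_punctured_ball_iff)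
  ultimately show ?thesis by (simp add: card_gt_0_iff)
qed

lemma level_subset_visited_doubling_tour:
  assumes same_shape: "K \<noteq> {}" "fst ` K \<subseteq> renumberings T"
    and radius: "d \<le> height T" "card (punctured_ball T d) \<le> 2 ^ k" and "1 \<le> d"
  shows "level T d \<subseteq> visited doubling_tour K T (sum (phase_length T) {..k})"
proof -
  let ?X = "\<lambda>j. {v. radius T j \<le> depth T v}"
  have "known_tree K \<in> renumberings T" using same_shape known_tree_in by blast
  note same_radius = radius_renumbering[OF tree this]
  have "d \<le> radius T k" using le_radius radius .
  then have "level T d \<subseteq> punctured_ball T (radius T k)"
    using \<open>1 \<le> d\<close> by (auto simp: mem_punctured_ball_iff level_def)
  also have "\<dots> \<subseteq> explored T (?X k) root" unfolding explored_within_radius[symmetric] by blast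
  also have "\<dots> \<subseteq> visited doubling_tour K T (sum (phase_length T) {..k})"
    unfolding doubling_tour_def
  proof (rule tour_phases)
    show "phase_length T j = 2 * card (explored T (?X j) root - {root})" for j
      by (simp add: explored_within_radius phase_length_def)
  qed (simp add: block_index_eq same_radius)
  finally show ?thesis .
qed

lemma cost_doubling_tour:
  assumes same_shape: "K \<noteq> {}" "fst ` K \<subseteq> renumberings T"
    and admissible: "1 \<le> d" "d \<le> height T"
  shows "cost doubling_tour K T d \<le> of_nat (8 * card (punctured_ball T d))"
proof -
  obtain k where power: "2 ^ k \<le> card (punctured_ball T d)" "card (punctured_ball T d) < 2 ^ Suc k"
    using ex_power_ivl1[of 2 "card (punctured_ball T d)"] card_punctured_ball_pos[OF admissible(1)]
    by (auto simp: Suc_le_eq)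
  have "cost doubling_tour K T d \<le> of_nat (sum (phase_length T) {..Suc k})"
    using same_shape admissible power(2) unfolding cost_le_iff
    by (intro level_subset_visited_doubling_tour) auto
  also have "sum (phase_length T) {..Suc k} \<le> 8 * card (punctured_ball T d)"
    using sum_phase_length_le[of T "Suc k"] power(1) by simp
  finally show ?thesis by simp
qed

end

section \<open>Knowledge with uncertain port numbers\<close>

text \<open>The set \<open>\<R> S\<close> consists of the trees that the agent cannot distinguish from \<open>S\<close>.\<close>

definition port_uncertainty :: "(ptree \<Rightarrow> ptree set) \<Rightarrow> bool" where
  "port_uncertainty \<R> \<longleftrightarrow> (\<forall>S. is_tree S \<longrightarrow> S \<in> \<R> S \<and> \<R> S \<subseteq> renumberings S)"

definition dist_knowledge :: "(ptree \<Rightarrow> ptree set) \<Rightarrow> knowledge set" where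
  "dist_knowledge \<R> = {\<R> S \<times> {e} | S e. is_tree S \<and> 1 \<le> e \<and> e \<le> height S}"

definition nodist_knowledge :: "(ptree \<Rightarrow> ptree set) \<Rightarrow> knowledge set" where
  "nodist_knowledge \<R> = {\<R> S \<times> {1..height S} | S. is_tree S \<and> 1 \<le> height S}"

abbreviation worst_overhead :: "algorithm \<Rightarrow> knowledge set \<Rightarrow> knowledge \<Rightarrow> nat \<Rightarrow> ennreal" where
  "worst_overhead A \<T> K m \<equiv> SUP K\<^sub>1\<in>{K\<^sub>1\<in>\<T>. K\<^sub>1 \<subseteq> K}. overhead A K\<^sub>1 m"

section \<open>The upper bound\<close>

lemma renumberings_eq: "is_tree S \<Longrightarrow> T \<in> renumberings S \<Longrightarrow> renumberings T = renumberings S"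
  by (auto simp: renumberings_def)

lemma (in rooted_tree) card_level_le_overhead:
  assumes "(T, d) \<in> K" "1 \<le> d" "d \<le> m"
  shows "of_nat (card (level T d)) \<le> of_nat d * overhead A K m"
proof -
  have "of_nat (card (level T d)) \<le> cost A K T d"
    using sum_card_levels_le_cost[of "{d}" A K] assms(2) by auto
  also have "\<dots> \<le> of_nat d * overhead A K m" using assms by (rule cost_le_overhead)
  finally show ?thesis .
qed

lemma (in rooted_tree) card_punctured_ball_le:
  fixes M :: ennreal
  assumes "\<And>j. 1 \<le> j \<Longrightarrow> j \<le> d \<Longrightarrow> of_nat (card (level T j)) \<le> of_nat j * M"
  shows "of_nat (card (punctured_ball T d)) \<le> of_nat d * (of_nat d * M)"
proof -
  have "of_nat (card (punctured_ball T d)) \<le> (\<Sum>j=1..d. of_nat (card (level T j)) :: ennreal)"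
    unfolding punctured_ball_def of_nat_sum[symmetric] by (intro of_nat_mono card_UN_le) simp
  also have "\<dots> \<le> (\<Sum>j=1..d. of_nat d * M)"
  proof (rule sum_mono)
    fix j assume within: "j \<in> {1..d}"
    then have "of_nat (card (level T j)) \<le> of_nat j * M" using assms by simp
    also have "\<dots> \<le> of_nat d * M" using within by (intro mult_right_mono) auto
    finally show "of_nat (card (level T j)) \<le> of_nat d * M" .
  qed
  finally show ?thesis by simp
qed

lemma (in rooted_tree) card_level_le_worst_overhead:
  assumes "port_uncertainty \<R>" "\<R> T \<times> {d} \<subseteq> K" "1 \<le> d" "d \<le> height T" "d \<le> m"
  shows "of_nat (card (level T d)) \<le> of_nat d * worst_overhead A (dist_knowledge \<R>) K m"
proof -
  have member: "(T, d) \<in> \<R> T \<times> {d}" using assms(1) tree by (simp add: port_uncertainty_def)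
  have knowledge: "\<R> T \<times> {d} \<in> dist_knowledge \<R>"
    unfolding dist_knowledge_def using assms(3,4) tree by force
  have "of_nat (card (level T d)) \<le> of_nat d * overhead A (\<R> T \<times> {d}) m"
    using member assms(3,5) by (rule card_level_le_overhead)
  also have "overhead A (\<R> T \<times> {d}) m \<le> worst_overhead A (dist_knowledge \<R>) K m"
    using knowledge assms(2) by (intro SUP_upper) simp
  finally show ?thesis by (simp add: mult_left_mono)
qed

lemma (in nontrivial_rooted_tree) cost_doubling_tour_le_worst_overhead:
  assumes uncertainty: "port_uncertainty \<R>"
    and known_shape: "K \<noteq> {}" "fst ` K \<subseteq> renumberings T"
    and contains: "\<And>j. 1 \<le> j \<Longrightarrow> j \<le> d \<Longrightarrow> \<R> T \<times> {j} \<subseteq> K"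
    and admissible: "1 \<le> d" "d \<le> height T" and "d \<le> m"
  shows "cost doubling_tour K T d \<le> of_nat d *
    (8 * of_nat m * worst_overhead A (dist_knowledge \<R>) K m)"
    (is "_ \<le> _ * (_ * ?M)")
proof -
  have "cost doubling_tour K T d \<le> of_nat (8 * card (punctured_ball T d))"
    using known_shape admissible by (rule cost_doubling_tour)
  also have "\<dots> = 8 * of_nat (card (punctured_ball T d))" by simp
  also have "of_nat (card (punctured_ball T d)) \<le> of_nat d * (of_nat d * ?M)"
    using uncertainty contains admissible(2) \<open>d \<le> m\<close>
    by (intro card_punctured_ball_le card_level_le_worst_overhead) auto
  also have "of_nat d * (of_nat d * ?M) \<le> of_nat d * (of_nat m * ?M)"
    using \<open>d \<le> m\<close> by (intro mult_left_mono mult_right_mono) auto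
  also have "8 * (of_nat d * (of_nat m * ?M)) = of_nat d * (8 * of_nat m * ?M)"
    by (simp add: mult_ac)
  finally show ?thesis by (simp add: mult_left_mono)
qed

theorem pen_bigo_linear:
  assumes uncertainty: "port_uncertainty \<R>\<^sub>1" "port_uncertainty \<R>\<^sub>2"
    and finer: "\<And>S T. is_tree S \<Longrightarrow> T \<in> \<R>\<^sub>2 S \<Longrightarrow> \<R>\<^sub>1 T \<subseteq> \<R>\<^sub>2 S"
  shows "pen_bigo (nodist_knowledge \<R>\<^sub>2) (dist_knowledge \<R>\<^sub>1) (\<lambda>m. m)"
  unfolding pen_bigo_def
proof (intro exI[of _ 8] exI[of _ doubling_tour] conjI allI impI ballI)
  show "is_algorithm doubling_tour" by (simp add: doubling_tour_def is_algorithm_tour)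
next
  fix A\<^sub>1 K\<^sub>2 and m :: nat
  assume "K\<^sub>2 \<in> nodist_knowledge \<R>\<^sub>2"
  then obtain S where shape: "is_tree S" "1 \<le> height S" and K\<^sub>2: "K\<^sub>2 = \<R>\<^sub>2 S \<times> {1..height S}"
    by (auto simp: nodist_knowledge_def)
  let ?M = "worst_overhead A\<^sub>1 (dist_knowledge \<R>\<^sub>1) K\<^sub>2 m"
  have "overhead doubling_tour K\<^sub>2 m \<le> 8 * of_nat m * ?M"
  proof (rule overhead_leI)
    fix T d assume in_K\<^sub>2: "(T, d) \<in> K\<^sub>2" and "d \<le> m"
    then have known: "T \<in> \<R>\<^sub>2 S" "T \<in> renumberings S" and admissible: "1 \<le> d" "d \<le> height S"
      using K\<^sub>2 uncertainty(2) shape(1) by (auto simp: port_uncertainty_def)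
    have height: "height T = height S" by (rule height_renumbering[OF shape(1) known(2)])
    interpret nontrivial_rooted_tree T
      using known(2) shape(2) height by unfold_locales (simp_all add: renumberings_def)
    have "fst ` K\<^sub>2 \<subseteq> renumberings T"
      using K\<^sub>2 uncertainty(2) shape(1) renumberings_eq[OF shape(1) known(2)]
      by (auto simp: port_uncertainty_def)
    moreover have "\<R>\<^sub>1 T \<times> {j} \<subseteq> K\<^sub>2" if "1 \<le> j" "j \<le> d" for j
      using that admissible finer[OF shape(1) known(1)] K\<^sub>2 by auto
    ultimately show "1 \<le> d \<and> cost doubling_tour K\<^sub>2 T d \<le> of_nat d * (8 * of_nat m * ?M)"
      using uncertainty(1) in_K\<^sub>2 admissible height \<open>d \<le> m\<close>
      by (intro conjI cost_doubling_tour_le_worst_overhead) auto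
  qed
  then show "overhead doubling_tour K\<^sub>2 m \<le> ennreal 8 * of_nat m * ?M" by simp
qed simp

section \<open>Trees given by a parent function\<close>

locale parent_function =
  fixes V :: "nat set" and r :: nat and par :: "nat \<Rightarrow> nat" and rank :: "nat \<Rightarrow> nat"
  assumes finite_V: "finite V" and r_in_V: "r \<in> V" and rank_r: "rank r = 0"
    and par_in_V: "v \<in> V \<Longrightarrow> v \<noteq> r \<Longrightarrow> par v \<in> V"
    and rank_par: "v \<in> V \<Longrightarrow> v \<noteq> r \<Longrightarrow> rank v = Suc (rank (par v))"
begin

definition parent_tree :: ptree where
  "parent_tree = \<lparr>nodes = V, root_node = r,
     nbrs = (\<lambda>v. if v \<in> V
       then sorted_list_of_set {u \<in> V. u \<noteq> r \<and> par u = v \<or> v \<noteq> r \<and> par v = u} else [])\<rparr>"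

lemma nodes_parent_tree [simp]: "nodes parent_tree = V"
  and root_parent_tree [simp]: "root_node parent_tree = r"
  by (simp_all add: parent_tree_def)

lemma adj_parent_tree:
  "adj parent_tree u v \<longleftrightarrow> u \<in> V \<and> v \<in> V \<and> (v \<noteq> r \<and> par v = u \<or> u \<noteq> r \<and> par u = v)"
  using finite_V by (auto simp: adj_def parent_tree_def)

lemma adj_parent_tree_sym: "adj parent_tree u v \<Longrightarrow> adj parent_tree v u"
  by (auto simp: adj_parent_tree)

lemma adj_rank_cases: "adj parent_tree u v \<Longrightarrow> u \<noteq> r \<and> v = par u \<or> rank v = Suc (rank u)"
  using rank_par by (auto simp: adj_parent_tree)

text \<open>In a cycle, both neighbours of a node of maximal rank would be its parent.\<close>

lemma not_is_cycle_parent_tree: "\<not> is_cycle parent_tree xs"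
proof
  assume cycle: "is_cycle parent_tree xs"
  then have "finite (set xs)" "set xs \<noteq> {}" by (auto simp: is_cycle_def)
  then obtain x where maximal: "x \<in> set xs" "rank x = Max (rank ` set xs)"
    using obtains_MAX[of "set xs" rank] by metis
  obtain a b where nbrs: "a \<in> set xs" "b \<in> set xs" "a \<noteq> b"
    "adj parent_tree x a" "adj parent_tree x b"
    by (rule is_cycle_two_neighbours[OF cycle maximal(1) adj_parent_tree_sym])
  have "rank y \<le> rank x" if "y \<in> set xs" for y using maximal(2) that by simp
  then have "a = par x" "b = par x"
    using nbrs adj_rank_cases by (metis Suc_n_not_le_n)+
  then show False using nbrs(3) by simp
qed

lemma par_induct [consumes 1, case_names r par]:
  assumes "v \<in> V" and "P r" and "\<And>v. v \<in> V \<Longrightarrow> v \<noteq> r \<Longrightarrow> P (par v) \<Longrightarrow> P v"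
  shows "P v"
  using assms(1)
proof (induction "rank v" arbitrary: v)
  case 0
  then have "v = r" using rank_par by fastforce
  then show ?case using assms(2) by simp
next
  case (Suc n)
  then have "v \<noteq> r" using rank_r by auto
  then show ?case using Suc rank_par par_in_V assms(3) by (metis Suc_inject)
qed

lemma is_tree_parent_tree: "is_tree parent_tree"
proof -
  have to_root: "(adj parent_tree)\<^sup>*\<^sup>* v r" if "v \<in> V" for v
    using that
  proof (induction rule: par_induct)
    case (par v)
    then have "adj parent_tree v (par v)" using par_in_V by (simp add: adj_parent_tree)
    then show ?case using par.IH by (rule converse_rtranclp_into_rtranclp)
  qed simp
  have "symp (adj parent_tree)" using adj_parent_tree_sym by (rule sympI)
  then have "(adj parent_tree)\<^sup>*\<^sup>* u v" if "u \<in> V" "v \<in> V" for u v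
    using to_root that by (meson rtranclp_trans sympD symp_rtranclp)
  moreover have "distinct (nbrs parent_tree v)" for v
    by (simp add: parent_tree_def)
  moreover have "set (nbrs parent_tree v) \<subseteq> V - {v}" for v
  proof
    fix w assume "w \<in> set (nbrs parent_tree v)"
    then have "adj parent_tree v w" by (simp add: adj_def)
    then show "w \<in> V - {v}" using rank_par[of v] by (auto simp: adj_parent_tree)
  qed
  moreover have "nbrs parent_tree v = []" if "v \<notin> V" for v
    using that by (simp add: parent_tree_def)
  ultimately show ?thesis
    unfolding is_tree_def
    using finite_V r_in_V not_is_cycle_parent_tree adj_parent_tree_sym by simp
qed

sublocale tree: rooted_tree parent_tree
  by unfold_locales (rule is_tree_parent_tree)

lemma depth_parent_tree:
  assumes "v \<in> V"
  shows "depth parent_tree v = rank v"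
proof (rule antisym)
  show "depth parent_tree v \<le> rank v"
    using assms
  proof (induction rule: par_induct)
    case r
    show ?case using tree.depth_root by simp
  next
    case (par v)
    then have "adj parent_tree (par v) v" using par_in_V by (simp add: adj_parent_tree)
    then show ?case using par tree.depth_adj_le rank_par by fastforce
  qed
next
  have "v \<in> nodes parent_tree" using assms by simp
  then show "rank v \<le> depth parent_tree v"
  proof (induction rule: tree.parent_induct)
    case (child v)
    then have "adj parent_tree (parent parent_tree v) v"
      using tree.child_of_parent by (force simp: children_def)
    then show ?case
      using child adj_rank_cases tree.depth_parent rank_par tree.parent_in_nodes by fastforce
  qed (simp add: rank_r)
qed

lemma children_parent_tree: "children parent_tree u = {v \<in> V. v \<noteq> r \<and> par v = u}"
proof (intro equalityI subsetI)
  fix v assume child: "v \<in> children parent_tree u"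
  then have "adj parent_tree u v" by (simp add: children_def)
  moreover from this have "rank v = Suc (rank u)"
    using child tree.adj_nodes by (simp add: children_def depth_parent_tree)
  ultimately show "v \<in> {v \<in> V. v \<noteq> r \<and> par v = u}"
    using rank_par[of u] by (auto simp: adj_parent_tree)
next
  fix v assume "v \<in> {v \<in> V. v \<noteq> r \<and> par v = u}"
  then show "v \<in> children parent_tree u"
    using rank_par[of v] par_in_V[of v]
    by (auto simp: children_def adj_parent_tree depth_parent_tree)
qed

lemma parent_parent_tree: "v \<in> V \<Longrightarrow> v \<noteq> r \<Longrightarrow> parent parent_tree v = par v"
  by (rule tree.parent_eqI) (simp add: children_parent_tree)

end

section \<open>The broom tree\<close>

text \<open>The node \<open>(i, k)\<close> is the \<open>k\<close>-th node of branch \<open>i\<close>, where \<open>1 \<le> i \<le> m\<close>: the nodes with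
  \<open>k \<le> i\<close> form a path from the root, and the \<open>m * i\<close> nodes with \<open>k > i\<close> are leaves attached to
  its end \<open>(i, i)\<close>. The root is \<open>(0, 0)\<close>.\<close>

definition broom_nodes :: "nat \<Rightarrow> nat set" where
  "broom_nodes m =
     prod_encode ` insert (0, 0) {(i, k). 1 \<le> i \<and> i \<le> m \<and> 1 \<le> k \<and> k \<le> i + m * i}"

definition broom_parent :: "nat \<Rightarrow> nat" where
  "broom_parent x = (case prod_decode x of (i, k) \<Rightarrow>
     if k \<le> 1 then prod_encode (0, 0) else prod_encode (i, min (k - 1) i))"

definition broom_rank :: "nat \<Rightarrow> nat" where
  "broom_rank x = (case prod_decode x of (i, k) \<Rightarrow> min k (Suc i))"

lemma broom_rank_encode [simp]: "broom_rank (prod_encode (i, k)) = min k (Suc i)"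
  by (simp add: broom_rank_def)

lemma broom_parent_encode [simp]:
  "broom_parent (prod_encode (i, k)) =
     (if k \<le> 1 then prod_encode (0, 0) else prod_encode (i, min (k - 1) i))"
  by (simp add: broom_parent_def)

lemma broom_nodes_encode [simp]:
  "prod_encode (i, k) \<in> broom_nodes m \<longleftrightarrow>
     (i, k) = (0, 0) \<or> 1 \<le> i \<and> i \<le> m \<and> 1 \<le> k \<and> k \<le> i + m * i"
  by (auto simp: broom_nodes_def)

lemma broom_nodesE:
  assumes "x \<in> broom_nodes m"
  obtains "x = prod_encode (0, 0)"
  | i k where "x = prod_encode (i, k)" "1 \<le> i" "i \<le> m" "1 \<le> k" "k \<le> i + m * i"
  using assms unfolding broom_nodes_def by auto

interpretation broom: parent_function "broom_nodes m" "prod_encode (0, 0)" broom_parent broom_rank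
  for m
proof
  have "{(i, k). 1 \<le> i \<and> i \<le> m \<and> 1 \<le> k \<and> k \<le> i + m * i} \<subseteq> {..m} \<times> {..m + m * m}"
    by (auto intro: order_trans[OF _ add_mono[OF _ mult_le_mono2]])
  then show "finite (broom_nodes m)"
    unfolding broom_nodes_def by (simp add: finite_subset[OF _ finite_cartesian_product])
next
  fix v assume "v \<in> broom_nodes m" "v \<noteq> prod_encode (0, 0)"
  then show "broom_parent v \<in> broom_nodes m" "broom_rank v = Suc (broom_rank (broom_parent v))"
    by (auto elim!: broom_nodesE simp: min_def)
qed auto

abbreviation broom_tree :: "nat \<Rightarrow> ptree" where
  "broom_tree \<equiv> broom.parent_tree"

lemma le_height_broom: "m \<le> height (broom_tree m)"
proof (cases "m = 0")
  case False
  then have "prod_encode (m, m) \<in> broom_nodes m" by simp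
  then show ?thesis
    using broom.tree.depth_le_height[of "prod_encode (m, m)" m] broom.depth_parent_tree by simp
qed simp

lemma broom_children_path:
  assumes "1 \<le> k" "k < i" "i \<le> m"
  shows "children (broom_tree m) (prod_encode (i, k)) = {prod_encode (i, Suc k)}"
  using assms by (auto simp: broom.children_parent_tree elim!: broom_nodesE split: if_splits)

lemma broom_children_end:
  assumes "1 \<le> i" "i \<le> m"
  shows "children (broom_tree m) (prod_encode (i, i)) = (\<lambda>k. prod_encode (i, k)) ` {i<..i + m * i}"
  using assms by (auto simp: broom.children_parent_tree elim!: broom_nodesE split: if_splits)

lemma card_broom_children_end:
  "1 \<le> i \<Longrightarrow> i \<le> m \<Longrightarrow> card (children (broom_tree m) (prod_encode (i, i))) = m * i"
  by (simp add: broom_children_end card_image inj_on_def)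

lemma broom_degree:
  assumes "1 \<le> k" "k \<le> i" "i \<le> m"
  shows "degree (broom_tree m) (prod_encode (i, k)) = (if k < i then 2 else Suc (m * i))"
  using assms broom.tree.degree_eq_Suc_card_children[of "prod_encode (i, k)" m]
  by (auto simp: broom_children_path card_broom_children_end)

lemma card_broom_level_ge:
  assumes "1 \<le> d" "d \<le> m"
  shows "m * (d - 1) \<le> card (level (broom_tree m) d)"
proof (cases "d = 1")
  case False
  define i where "i = d - 1"
  then have branch: "1 \<le> i" "i \<le> m" "Suc i = d" using False assms by auto
  then have "depth (broom_tree m) (prod_encode (i, i)) = i"
    by (simp add: broom.depth_parent_tree)
  then have "children (broom_tree m) (prod_encode (i, i)) \<subseteq> level (broom_tree m) d"
    using broom.tree.children_subset_level[of m "prod_encode (i, i)"] branch(3) by simp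
  moreover have "finite (level (broom_tree m) d)" using broom.finite_V by (simp add: level_def)
  ultimately show ?thesis using card_broom_children_end[OF branch(1,2)] by (metis card_mono i_def)
qed simp

text \<open>Looking for level \<open>d\<close> in a broom tree, it is useless to visit the leaves of a branch whose
  path ends above level \<open>d - 1\<close>; such an end is recognised by its degree.\<close>

definition broom_turn :: "nat \<Rightarrow> nat \<Rightarrow> nat \<Rightarrow> bool" where
  "broom_turn d k \<delta> \<longleftrightarrow> d \<le> k \<or> 0 < k \<and> Suc k < d \<and> 2 < \<delta>"

definition known_distance :: "knowledge \<Rightarrow> nat" where
  "known_distance K = snd (SOME x. x \<in> K)"

lemma known_distance_in: "K \<noteq> {} \<Longrightarrow> known_distance K \<in> snd ` K"
  using some_in_eq by (auto simp: known_distance_def)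

definition broom_tour :: algorithm where
  "broom_tour = tour (\<lambda>K _. broom_turn (known_distance K))"

definition broom_stops :: "nat \<Rightarrow> nat \<Rightarrow> nat set" where
  "broom_stops m d = {v. broom_turn d (depth (broom_tree m) v) (degree (broom_tree m) v)}"

abbreviation broom_explored :: "nat \<Rightarrow> nat \<Rightarrow> nat set" where
  "broom_explored m d \<equiv> explored (broom_tree m) (broom_stops m d) (prod_encode (0, 0))"

lemma broom_explored_path_iff:
  assumes "2 \<le> m" "1 \<le> d" "1 \<le> i" "i \<le> m" "1 \<le> k" "k \<le> i"
  shows "prod_encode (i, k) \<in> broom_explored m d \<longleftrightarrow> k \<le> d"
  using assms(5,6)
proof (induction k rule: nat_induct_at_least)
  case base
  have "prod_encode (0, 0) \<notin> broom_stops m d"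
    using assms(2) by (simp add: broom_stops_def broom_turn_def broom.depth_parent_tree)
  then show ?case
    using broom.tree.explored_root_iff_parent[of "prod_encode (i, 1)" m "broom_stops m d"] assms
    by (simp add: broom.parent_parent_tree explored.start)
next
  case (Suc k)
  then have "prod_encode (i, k) \<in> broom_stops m d \<longleftrightarrow> d \<le> k"
    using assms broom_degree[of k i m]
    by (simp add: broom_stops_def broom_turn_def broom.depth_parent_tree)
  then show ?case
    using broom.tree.explored_root_iff_parent[of "prod_encode (i, Suc k)" m "broom_stops m d"]
      assms Suc
    by (auto simp: broom.parent_parent_tree)
qed

lemma broom_explored_leaf_iff:
  assumes "2 \<le> m" "1 \<le> d" "1 \<le> i" "i \<le> m" "i < k" "k \<le> i + m * i"
  shows "prod_encode (i, k) \<in> broom_explored m d \<longleftrightarrow> d = Suc i"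
proof -
  have "2 \<le> m * i" using assms(1,3) by (metis mult_le_mono mult_1_right)
  then have "prod_encode (i, i) \<in> broom_stops m d \<longleftrightarrow> d \<noteq> Suc i"
    using assms broom_degree[of i i m]
    by (auto simp: broom_stops_def broom_turn_def broom.depth_parent_tree)
  then show ?thesis
    using broom.tree.explored_root_iff_parent[of "prod_encode (i, k)" m "broom_stops m d"]
      broom_explored_path_iff[of m d i i] assms
    by (auto simp: broom.parent_parent_tree)
qed

lemma broom_level_subset_explored:
  assumes "2 \<le> m" "1 \<le> d"
  shows "level (broom_tree m) d \<subseteq> broom_explored m d"
proof
  fix v assume "v \<in> level (broom_tree m) d"
  then have at_level: "v \<in> broom_nodes m" "broom_rank v = d"
    using broom.depth_parent_tree by (auto simp: level_def)
  show "v \<in> broom_explored m d"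
    using at_level(1)
  proof (cases rule: broom_nodesE)
    case (2 i k)
    then show ?thesis
      using at_level(2) assms broom_explored_path_iff[of m d i k]
        broom_explored_leaf_iff[of m d i k]
      by (cases "k \<le> i") auto
  qed (simp add: explored.start)
qed

lemma card_broom_explored_le:
  assumes "2 \<le> m" "1 \<le> d"
  shows "card (broom_explored m d - {prod_encode (0, 0)}) \<le> 2 * m * d"
    (is "card (?E - {?r}) \<le> _")
proof -
  let ?B = "{1..m} \<times> {1..d} \<union> {d - 1} \<times> {d..d - 1 + m * (d - 1)}"
  have "?E - {?r} \<subseteq> prod_encode ` ?B"
  proof
    fix v assume v_explored: "v \<in> ?E - {?r}"
    then have "v \<in> broom_nodes m" using broom.tree.explored_subset_nodes[of ?r m] by auto
    then show "v \<in> prod_encode ` ?B"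
    proof (cases rule: broom_nodesE)
      case (2 i k)
      then have "if k \<le> i then k \<le> d else d = Suc i"
        using v_explored assms broom_explored_path_iff[of m d i k]
          broom_explored_leaf_iff[of m d i k]
        by simp
      then have "(i, k) \<in> ?B" using 2 by (auto split: if_splits)
      then show ?thesis using 2(1) by blast
    qed (use v_explored in simp)
  qed
  then have "card (?E - {?r}) \<le> card ?B"
    by (rule surj_card_le[rotated]) simp
  also have "\<dots> \<le> card ({1..m} \<times> {1..d}) + card ({d - 1} \<times> {d..d - 1 + m * (d - 1)})"
    by (rule card_Un_le)
  also have "\<dots> \<le> m * d + m * (d - 1)" using assms(2) by (simp add: card_cartesian_product)
  also have "\<dots> \<le> 2 * m * d" by (simp add: diff_mult_distrib2 mult.commute)
  finally show ?thesis .
qed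

lemma cost_broom_tour:
  assumes m_ge: "2 \<le> m" and renumbering: "T \<in> renumberings (broom_tree m)" and d_pos: "1 \<le> d"
    and knowledge: "K \<noteq> {}" "snd ` K \<subseteq> {d}"
  shows "cost broom_tour K T d \<le> of_nat (4 * m * d)"
proof -
  note same_tree = broom.is_tree_parent_tree renumbering
  note same_root = root_renumbering[OF same_tree]
  interpret nontrivial_rooted_tree T
    using renumbering m_ge le_height_broom[of m] height_renumbering[OF same_tree]
    by unfold_locales (simp_all add: renumberings_def)
  let ?E = "explored T (broom_stops m d) root"
  have explored_eq: "?E = broom_explored m d"
    using explored_cong[OF children_renumbering[OF same_tree]] same_root by simp
  have "known_distance K = d" using knowledge known_distance_in by blast
  then have "?E \<subseteq> visited broom_tour K T (2 * card (?E - {root}))"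
    unfolding broom_tour_def
    by (intro tour_single_phase)
      (simp add: broom_stops_def depth_renumbering[OF same_tree] degree_renumbering[OF same_tree])
  moreover have "level T d \<subseteq> ?E"
    unfolding explored_eq level_renumbering[OF same_tree]
    using m_ge d_pos by (rule broom_level_subset_explored)
  ultimately have "cost broom_tour K T d \<le> of_nat (2 * card (?E - {root}))"
    unfolding cost_le_iff by simp
  also have "2 * card (?E - {root}) \<le> 4 * m * d"
    using card_broom_explored_le[OF m_ge d_pos] unfolding explored_eq
    by (simp add: same_root mult_ac)
  finally show ?thesis by simp
qed

section \<open>The lower bound\<close>

lemma overhead_broom_tour_le:
  assumes "2 \<le> m" "R \<subseteq> renumberings (broom_tree m)" "1 \<le> e"
  shows "overhead broom_tour (R \<times> {e}) m \<le> of_nat (4 * m)"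
proof (rule overhead_leI)
  fix T d assume "(T, d) \<in> R \<times> {e}"
  then have "T \<in> renumberings (broom_tree m)" "1 \<le> d" "R \<times> {e} \<noteq> {}" "snd ` (R \<times> {e}) \<subseteq> {d}"
    using assms by auto
  then have "cost broom_tour (R \<times> {e}) T d \<le> of_nat (4 * m * d)"
    using assms(1) by (intro cost_broom_tour)
  then show "1 \<le> d \<and> cost broom_tour (R \<times> {e}) T d \<le> of_nat d * of_nat (4 * m)"
    using \<open>1 \<le> d\<close> by (simp add: mult_ac)
qed

lemma overhead_broom_ge:
  assumes "1 \<le> m" "{broom_tree m} \<times> {1..m} \<subseteq> K"
  shows "of_nat (m * (m - 1)) \<le> 2 * overhead A K m"
proof -
  let ?T = "broom_tree m"
  let ?leaves = "\<Sum>d=1..m. card (level ?T d)"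
  obtain d where late_level: "d \<in> {1..m}" "of_nat ?leaves \<le> cost A K ?T d"
    by (rule broom.tree.sum_card_levels_le_cost[of "{1..m}"]) (use assms(1) in auto)
  have "2 * (\<Sum>d=1..n. d - 1) = n * (n - 1)" for n :: nat
    by (induction n) (auto simp: algebra_simps)
  then have "m * (m * (m - 1)) = 2 * (\<Sum>d=1..m. m * (d - 1))"
    by (simp add: mult.left_commute flip: sum_distrib_left)
  also have "\<dots> \<le> 2 * ?leaves"
    by (intro mult_left_mono sum_mono card_broom_level_ge) auto
  finally have "of_nat (m * (m * (m - 1))) \<le> (of_nat (2 * ?leaves) :: ennreal)"
    by (rule of_nat_mono)
  also have "\<dots> \<le> 2 * cost A K ?T d" using late_level(2) by (simp add: mult_left_mono)
  also have "\<dots> \<le> 2 * (of_nat d * overhead A K m)"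
    using late_level(1) assms(2) by (intro mult_left_mono cost_le_overhead) auto
  also have "\<dots> \<le> 2 * (of_nat m * overhead A K m)"
    using late_level(1) by (intro mult_left_mono mult_right_mono) auto
  finally have "of_nat m * of_nat (m * (m - 1)) \<le> of_nat m * (2 * overhead A K m)"
    by (simp add: mult_ac)
  then show ?thesis using assms(1) by (simp add: ennreal_mult_le_mult_iff)
qed

lemma worst_overhead_broom_tour_le:
  assumes "2 \<le> m" "fst ` K \<subseteq> renumberings (broom_tree m)"
  shows "worst_overhead broom_tour (dist_knowledge \<R>) K m \<le> of_nat (4 * m)"
proof (rule SUP_least)
  fix K\<^sub>1 assume "K\<^sub>1 \<in> {K\<^sub>1\<in>dist_knowledge \<R>. K\<^sub>1 \<subseteq> K}"
  then obtain R e where K\<^sub>1: "K\<^sub>1 = R \<times> {e}" "1 \<le> e" "R \<times> {e} \<subseteq> K"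
    by (auto simp: dist_knowledge_def)
  then have "R \<subseteq> renumberings (broom_tree m)" using assms(2) by force
  then show "overhead broom_tour K\<^sub>1 m \<le> of_nat (4 * m)"
    unfolding K\<^sub>1(1) using assms(1) K\<^sub>1(2) by (intro overhead_broom_tour_le)
qed

lemma linear_le_if_overhead_broom_le:
  assumes "2 \<le> m" "{broom_tree m} \<times> {1..m} \<subseteq> K" "0 \<le> c"
    and "overhead A K m \<le> ennreal c * of_nat n * of_nat (4 * m)"
  shows "real m \<le> 16 * c * real n"
proof -
  have "of_nat (m * (m - 1)) \<le> 2 * overhead A K m"
    using assms(1,2) by (intro overhead_broom_ge) auto
  also have "\<dots> \<le> 2 * (ennreal c * of_nat n * of_nat (4 * m))"
    using assms(4) by (rule mult_left_mono) simp
  also have "\<dots> = of_nat (2 * (4 * m)) * of_nat n * ennreal c"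
    by (simp only: of_nat_mult of_nat_numeral mult_ac)
  also have "\<dots> = ennreal (real m * (8 * c * real n))"
    using assms(3)
    by (simp add: ennreal_of_nat_eq_real_of_nat mult_ac flip: ennreal_mult of_nat_mult) simp
  finally have "real m * real (m - 1) \<le> real m * (8 * c * real n)"
    using assms(3) by (simp add: ennreal_of_nat_eq_real_of_nat)
  then have "real (m - 1) \<le> 8 * c * real n"
    using assms(1) by (simp add: mult_le_cancel_left)
  then show ?thesis using assms(1) by linarith
qed

theorem pen_bigo_imp_linear_bigo:
  assumes uncertainty: "port_uncertainty \<R>\<^sub>2"
    and penalty: "pen_bigo (nodist_knowledge \<R>\<^sub>2) (dist_knowledge \<R>\<^sub>1) f"
  shows "(\<lambda>m. real m) \<in> O(\<lambda>m. real (f m))"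
proof -
  obtain c A\<^sub>2 where "c > 0" and overhead_le: "\<And>A\<^sub>1 K\<^sub>2 m. is_algorithm A\<^sub>1 \<Longrightarrow>
    K\<^sub>2 \<in> nodist_knowledge \<R>\<^sub>2 \<Longrightarrow> 1 \<le> m \<Longrightarrow> overhead A\<^sub>2 K\<^sub>2 m \<le> ennreal c * of_nat (f m) *
      worst_overhead A\<^sub>1 (dist_knowledge \<R>\<^sub>1) K\<^sub>2 m"
    using penalty unfolding pen_bigo_def by blast
  have "real m \<le> 16 * c * real (f m)" if "2 \<le> m" for m
  proof -
    let ?S = "broom_tree m"
    let ?K\<^sub>2 = "\<R>\<^sub>2 ?S \<times> {1..height ?S}"
    have tree: "is_tree ?S" "m \<le> height ?S" by (rule broom.is_tree_parent_tree le_height_broom)+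
    then have "?K\<^sub>2 \<in> nodist_knowledge \<R>\<^sub>2"
      using \<open>2 \<le> m\<close> unfolding nodist_knowledge_def by force
    then have "overhead A\<^sub>2 ?K\<^sub>2 m \<le> ennreal c * of_nat (f m) *
        worst_overhead broom_tour (dist_knowledge \<R>\<^sub>1) ?K\<^sub>2 m"
      using \<open>2 \<le> m\<close> by (intro overhead_le) (simp_all add: broom_tour_def is_algorithm_tour)
    also have "worst_overhead broom_tour (dist_knowledge \<R>\<^sub>1) ?K\<^sub>2 m \<le> of_nat (4 * m)"
      using \<open>2 \<le> m\<close> uncertainty tree(1)
      by (intro worst_overhead_broom_tour_le) (auto simp: port_uncertainty_def)
    finally have "overhead A\<^sub>2 ?K\<^sub>2 m \<le> ennreal c * of_nat (f m) * of_nat (4 * m)"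
      by (simp only: mult_left_mono zero_le)
    moreover have "{?S} \<times> {1..m} \<subseteq> ?K\<^sub>2"
      using tree uncertainty by (auto simp: port_uncertainty_def)
    ultimately show ?thesis
      using \<open>2 \<le> m\<close> \<open>c > 0\<close> by (intro linear_le_if_overhead_broom_le) auto
  qed
  then show ?thesis
    by (intro bigoI[of _ "16 * c"] eventually_sequentiallyI[of 2]) auto
qed

theorem not_pen_bigo_sublinear:
  assumes "port_uncertainty \<R>\<^sub>2" "(\<lambda>m. real (f m)) \<in> o(\<lambda>m. real m)"
  shows "\<not> pen_bigo (nodist_knowledge \<R>\<^sub>2) (dist_knowledge \<R>\<^sub>1) f"
proof
  assume "pen_bigo (nodist_knowledge \<R>\<^sub>2) (dist_knowledge \<R>\<^sub>1) f"
  then have "(\<lambda>m. real m) \<in> O(\<lambda>m. real (f m))"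
    by (rule pen_bigo_imp_linear_bigo[OF assms(1)])
  then have "(\<lambda>m. real m) \<in> o(\<lambda>m. real m)"
    using assms(2) by (rule landau_o.big_small_trans)
  then have "eventually (\<lambda>m. real m = 0) sequentially" by (simp only: landau_o.small_refl_iff)
  then show False by (auto simp: eventually_sequentially)
qed

section \<open>The three penalties\<close>

lemma port_uncertainty_complete: "port_uncertainty (\<lambda>S. {S})"
  by (simp add: port_uncertainty_def renumberings_refl)

lemma port_uncertainty_blind: "port_uncertainty renumberings"
  by (simp add: port_uncertainty_def renumberings_refl)

lemma comp_dist_eq: "comp_dist = dist_knowledge (\<lambda>S. {S})"
  by (auto simp: comp_dist_def dist_knowledge_def)

lemma blind_dist_eq: "blind_dist = dist_knowledge renumberings"
proof -
  have "{(T, e) | T. T \<in> renumberings S} = renumberings S \<times> {e}" for S and e :: nat by auto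
  then show ?thesis by (simp only: blind_dist_def dist_knowledge_def)
qed

lemma comp_nodist_eq: "comp_nodist = nodist_knowledge (\<lambda>S. {S})"
proof -
  have "{(S, d) | d. 1 \<le> d \<and> d \<le> height S} = {S} \<times> {1..height S}" for S by auto
  then show ?thesis by (simp add: comp_nodist_def nodist_knowledge_def)
qed

lemma blind_nodist_eq: "blind_nodist = nodist_knowledge renumberings"
proof -
  have "{(T, d) | T d. T \<in> renumberings S \<and> 1 \<le> d \<and> d \<le> height S}
    = renumberings S \<times> {1..height S}" for S by auto
  then show ?thesis by (simp only: blind_nodist_def nodist_knowledge_def)
qed

theorem theorem3p3:
  shows "\<forall>(\<T>\<^sub>2, \<T>\<^sub>1) \<in> {(comp_nodist, comp_dist), (blind_nodist, blind_dist),
                          (blind_nodist, comp_dist)}.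
           pen_bigo \<T>\<^sub>2 \<T>\<^sub>1 (\<lambda>m. m) \<and>
           \<not> (\<exists>f :: nat \<Rightarrow> nat. (\<lambda>m. real (f m)) \<in> o(\<lambda>m. real m) \<and> pen_bigo \<T>\<^sub>2 \<T>\<^sub>1 f)"
proof -
  note uncertainty = port_uncertainty_complete port_uncertainty_blind
  note knowledge = comp_dist_eq blind_dist_eq comp_nodist_eq blind_nodist_eq
  have "pen_bigo comp_nodist comp_dist (\<lambda>m. m)" "pen_bigo blind_nodist blind_dist (\<lambda>m. m)"
    "pen_bigo blind_nodist comp_dist (\<lambda>m. m)"
    unfolding knowledge using uncertainty renumberings_eq by (auto intro!: pen_bigo_linear)
  moreover have "\<not> pen_bigo comp_nodist \<T>\<^sub>1 f" "\<not> pen_bigo blind_nodist \<T>\<^sub>1 f"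
    if "(\<lambda>m. real (f m)) \<in> o(\<lambda>m. real m)" "\<T>\<^sub>1 \<in> {comp_dist, blind_dist}" for \<T>\<^sub>1 f
    using that uncertainty unfolding knowledge by (auto dest: not_pen_bigo_sublinear)
  ultimately show ?thesis by auto
qed

end
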